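(* Let $\boldsymbol{X}=\{X_n\}_{n\ge 1}$ be a threshold $F^\alpha$-scheme, i.e. a sequence of real random variables satisfying condition C2 (stated in the context) with a continuous distribution function $F$, a positive sequence $\boldsymbol{\alpha}=\{\alpha_n\}_{n\ge1}$ and a non-decreasing real sequence $\{\ell_n\}_{n\ge 1}$, and let $\boldsymbol{\mathcal{X}}=\{\mathcal{X}_n\}_{n\ge 1}$ be the $F^\alpha$-scheme specified by $F$ and $\boldsymbol{\alpha}$. Then one can construct the sequences $\boldsymbol{X}$ and $\boldsymbol{\mathcal{X}}$ (i.e. sequences with the same respective laws) on a common probability space so that there exists a random time $T$, with $T<\infty$ almost surely, such that $(M_n, I_n)=(\mathcal{M}_n, \mathcal{I}_n)$ for all $n\ge T$.
   Context: For a sequence $\boldsymbol{X}=\{X_n\}_{n\ge 1}$ of random variables on a common probability space, $M_n:=\max_{1\le k\le n}X_k$ ($n\ge1$) are the partial maxima, and $I_1:=1$, $I_n:=\mathbf{1}(X_n>M_{n-1})$ ($n\ge 2$) are the record indicators. The $F^\alpha$-scheme specified by a continuous distribution function (d.f.) $F$ and a positive sequence $\boldsymbol{\alpha}=\{\alpha_n\}_{n\ge 1}$ is a sequence $\boldsymbol{\mathcal{X}}=\{\mathcal{X}_n\}_{n\ge1}$ of independent random variables such that $\mathcal{X}_n$ has d.f. $F^{\alpha_n}$, $n\ge1$. Its partial maxima are $\mathcal{M}_n:=\max_{1\le k\le n}\mathcal{X}_k$ and its record indicators are $\mathcal{I}_1:=1$, $\mathcal{I}_n:=\mathbf{1}(\mathcal{X}_n>\mathcal{M}_{n-1})$,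 $n\ge2$. Put $s_n:=\sum_{k=1}^n\alpha_k$. "ev." (eventually) means "for all sufficiently large $n$". For a d.f. $G$, $G^{\leftarrow}(u):=\inf\{x\in\mathbb{R}: G(x)\ge u\}$, $u\in(0,1)$, and $G^{\leftarrow}(1-)$ is its left limit at $1$. $F_n$ denotes the d.f. of $X_n$, and $F_{n|x_1,\ldots,x_{n-1}}(x_n):=\mathbf{P}(X_n\le x_n\mid X_1=x_1,\ldots,X_{n-1}=x_{n-1})$ is the conditional d.f. of $X_n$ given the preceding observations. Condition C2: there exist a continuous d.f. $F$, a positive sequence $\boldsymbol{\alpha}$ with $\lim_{n\to\infty}s_n=\infty$, and a non-decreasing real sequence $\{\ell_n\}_{n\ge1}$ such that: (i) $F_n^{\leftarrow}(1-)\le F^{\leftarrow}(1-)$ for $n\ge1$; (ii) $F_{n|x_1,\ldots,x_{n-1}}(x_n)=F_n(x_n)$ for $x_n\ge\ell_n$, $x_j\in\mathbb{R}$, $1\le j<n$, $n\ge2$; (iii) $\sum_{n\ge1}\delta_n<\infty$, where $\delta_n:=\int_{(\ell_n,\infty)}|d(F_n-F^{\alpha_n})|$ is the total variation distance between the restrictions of the distributions $F_n$ and $F^{\alpha_n}$ to the half-line $(\ell_n,\infty)$; (iv) $\mathbf{P}(\mathcal{M}_n>\ell_n\ \text{ev.})=1$ for the partial maxima $\{\mathcal{M}_n\}$ of the $F^\alpha$-scheme specified by $F$ and $\boldsymbol{\alpha}$.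
   Formalization: The formal theorem additionally assumes P(X_n = F^←(1−)) = 0 for all n ≥ 1; without it the claim fails (F uniform on [0,1], α_n = 1, ℓ_n = −1, X_1 = 1, other X_n i.i.d. uniform), and given C2 this condition is necessary for the conclusion. *)

theory Defs
  imports "HOL-Probability.Probability" "HOL-Library.Extended_Nat" "HOL-Library.Disjoint_Sets"
begin

(* Sequences are indexed by n >= 1; the value at index 0 is never used. *)

definition partial_max :: "(nat \<Rightarrow> 'a \<Rightarrow> real) \<Rightarrow> nat \<Rightarrow> 'a \<Rightarrow> real" where
  "partial_max X n \<omega> = Max ((\<lambda>k. X k \<omega>) ` {1..n})"

definition record_indicator :: "(nat \<Rightarrow> 'a \<Rightarrow> real) \<Rightarrow> nat \<Rightarrow> 'a \<Rightarrow> nat" where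
  "record_indicator X n \<omega> =
     (if n = 1 then 1 else if partial_max X (n - 1) \<omega> < X n \<omega> then 1 else 0)"

definition seq_law :: "'a measure \<Rightarrow> (nat \<Rightarrow> 'a \<Rightarrow> real) \<Rightarrow> (nat \<Rightarrow> real) measure" where
  "seq_law M X = distr M (PiM {1..} (\<lambda>_. borel)) (\<lambda>\<omega>. \<lambda>n\<in>{1..}. X n \<omega>)"

definition is_df :: "(real \<Rightarrow> real) \<Rightarrow> bool" where
  "is_df G \<longleftrightarrow> (\<exists>\<mu>. real_distribution \<mu> \<and> cdf \<mu> = G)"

definition df_of :: "'a measure \<Rightarrow> ('a \<Rightarrow> real) \<Rightarrow> real \<Rightarrow> real" where
  "df_of M Z = cdf (distr M borel Z)"

(* The distribution with d.f. F^a, for a continuous d.f. F and a > 0. *)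
definition pow_distr :: "(real \<Rightarrow> real) \<Rightarrow> real \<Rightarrow> real measure" where
  "pow_distr F a = interval_measure (\<lambda>x. F x powr a)"

definition falpha_scheme ::
  "'a measure \<Rightarrow> (nat \<Rightarrow> 'a \<Rightarrow> real) \<Rightarrow> (real \<Rightarrow> real) \<Rightarrow> (nat \<Rightarrow> real) \<Rightarrow> bool" where
  "falpha_scheme N Y F \<alpha> \<longleftrightarrow>
     prob_space N \<and> is_df F \<and> continuous_on UNIV F \<and> (\<forall>n\<ge>1. 0 < \<alpha> n) \<and>
     prob_space.indep_vars N (\<lambda>_. borel) Y {1..} \<and>
     (\<forall>n\<ge>1. df_of N (Y n) = (\<lambda>x. F x powr \<alpha> n))"

definition quantile :: "(real \<Rightarrow> real) \<Rightarrow> real \<Rightarrow> real" where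
  "quantile G u = Inf {x. u \<le> G x}"

(* The left limit of the quantile function at 1, possibly infinite. *)
definition right_endpoint :: "(real \<Rightarrow> real) \<Rightarrow> ereal" where
  "right_endpoint G = Lim (at_left 1) (\<lambda>u. ereal (quantile G u))"

(* G x y is a version of P(X_n <= y | X_1 = x_1, ..., X_(n-1) = x_(n-1)): a d.f. in y for every x,
   measurable in x, and satisfying the defining identity of conditional probability. *)
definition conditional_df ::
  "'a measure \<Rightarrow> (nat \<Rightarrow> 'a \<Rightarrow> real) \<Rightarrow> nat \<Rightarrow> ((nat \<Rightarrow> real) \<Rightarrow> real \<Rightarrow> real) \<Rightarrow> bool" where
  "conditional_df M X n G \<longleftrightarrow>
     (let S = PiM {1..<n} (\<lambda>_. borel); past = (\<lambda>\<omega>. \<lambda>k\<in>{1..<n}. X k \<omega>) in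
       (\<forall>x\<in>space S. is_df (G x)) \<and>
       (\<forall>y. (\<lambda>x. G x y) \<in> borel_measurable S) \<and>
       (\<forall>y. \<forall>B\<in>sets S.
          measure M {\<omega> \<in> space M. past \<omega> \<in> B \<and> X n \<omega> \<le> y} =
          (LINT x:B|distr M S past. G x y)))"

(* The total variation of mu - nu on A, for finite Borel measures mu and nu; the supremum is over a
   bounded set. *)
definition tv_on :: "real set \<Rightarrow> real measure \<Rightarrow> real measure \<Rightarrow> real" where
  "tv_on A \<mu> \<nu> =
     (SUP P\<in>{P. finite P \<and> disjoint P \<and> P \<subseteq> sets borel \<and> \<Union>P \<subseteq> A}.
        \<Sum>B\<in>P. \<bar>measure \<mu> B - measure \<nu> B\<bar>)"

(* Conditional d.f.s are unique only up to null sets, so (ii) asks for some version with the stated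
   property.  In (iv) the F^alpha-scheme is realised as the coordinate sequence on the product of
   its marginal laws. *)
definition threshold_falpha_scheme ::
  "'a measure \<Rightarrow> (nat \<Rightarrow> 'a \<Rightarrow> real) \<Rightarrow> (real \<Rightarrow> real) \<Rightarrow> (nat \<Rightarrow> real) \<Rightarrow> (nat \<Rightarrow> real) \<Rightarrow> bool"
where
  "threshold_falpha_scheme M X F \<alpha> l \<longleftrightarrow>
     prob_space M \<and> (\<forall>n\<ge>1. X n \<in> borel_measurable M) \<and>
     is_df F \<and> continuous_on UNIV F \<and>
     (\<forall>n\<ge>1. 0 < \<alpha> n) \<and> filterlim (\<lambda>n. \<Sum>k=1..n. \<alpha> k) at_top sequentially \<and>
     mono_on {1..} l \<and>
     \<comment> \<open>(i)\<close>
     (\<forall>n\<ge>1. right_endpoint (df_of M (X n)) \<le> right_endpoint F) \<and>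
     \<comment> \<open>(ii)\<close>
     (\<forall>n\<ge>2. \<exists>G. conditional_df M X n G \<and>
        (\<forall>x\<in>space (PiM {1..<n} (\<lambda>_. borel)). \<forall>y\<ge>l n. G x y = df_of M (X n) y)) \<and>
     \<comment> \<open>(iii)\<close>
     summable (\<lambda>n. tv_on {l (Suc n)<..} (distr M borel (X (Suc n))) (pow_distr F (\<alpha> (Suc n)))) \<and>
     \<comment> \<open>(iv)\<close>
     (AE z in PiM {1..} (\<lambda>n. pow_distr F (\<alpha> n)).
        \<forall>\<^sub>F n in sequentially. l n < partial_max (\<lambda>k z. z k) n z)"

(* Condition (i) of a threshold F^alpha-scheme does not exclude an atom of X_n at the right endpoint
   of F.  The coupling theorem fails without excluding such an atom: if F is the uniform d.f. on
   [0,1], all alpha_n = 1, all l_n = -1, X_1 = 1 and X_2, X_3, ... are independent and uniform on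
   [0,1], then (i)-(iv) hold, but the partial maxima of X are all 1 whereas those of the
   F^alpha-scheme are all less than 1 almost surely. *)
definition no_atom_at_right_endpoint ::
  "'a measure \<Rightarrow> (nat \<Rightarrow> 'a \<Rightarrow> real) \<Rightarrow> (real \<Rightarrow> real) \<Rightarrow> bool" where
  "no_atom_at_right_endpoint M X F \<longleftrightarrow>
     (\<forall>n\<ge>1. AE \<omega> in M. ereal (X n \<omega>) \<noteq> right_endpoint F)"

end

theory Submission
  imports Defs
begin

text \<open>
  Only the part of \<open>X n\<close> above the threshold \<open>l n\<close> can matter for late maxima, and that part is
  independent of the past: condition (ii) says that the conditional d.f. of \<open>X n\<close> is the
  unconditional one from \<open>l n\<close> on, so the clipped variables \<open>max (X n) (l n)\<close> are independent
  (\<open>indep_vars_max_threshold\<close>), however dependent the \<open>X n\<close> themselves are.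

  This allows the \<open>F\<^sup>\<alpha>\<close>-scheme to be built from \<open>X\<close> with additional randomness.  Let \<open>\<mu>\<close> be the law of
  \<open>X n\<close> and \<open>\<nu>\<close> the distribution with d.f. \<open>F\<close> to the power \<open>\<alpha> n\<close>.  A value \<open>x > l n\<close> of \<open>X n\<close> is kept
  with probability \<open>k x\<close>, where \<open>k\<close> is the density with respect to \<open>\<mu>\<close> of the part that \<open>\<mu>\<close> and \<open>\<nu>\<close> have in common above
  \<open>l n\<close>; every other value is replaced by an independent draw from the normalized remainder of \<open>\<nu>\<close>
  (\<open>threshold_kernel_exists\<close>).  The result has law \<open>\<nu>\<close>, it depends on \<open>X n\<close> only through
  \<open>max (X n) (l n)\<close>, and it differs from \<open>X n\<close> while one of the two exceeds \<open>l n\<close> with probability at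
  most \<open>2 \<delta>\<close>, where \<open>\<delta>\<close> is the total variation distance in (iii).
  Independent randomness for different \<open>n\<close> therefore
  yields a sequence of independent variables with the right marginals, i.e. an \<open>F\<^sup>\<alpha>\<close>-scheme
  (\<open>distr_independent_randomization\<close>).

  By (iii) and the Borel--Cantelli lemma, the two sequences agree above the thresholds from some
  index on.  The finitely many earlier values are eventually irrelevant: all values lie in
  \<open>{x. F x < 1}\<close> almost surely (by (i) and the absence of atoms at the right endpoint for \<open>X\<close>, by
  continuity of \<open>F\<close> for the scheme), and since the \<open>\<alpha> n\<close> have a divergent sum, the scheme exceeds every
  such level (\<open>AE_exceeds_level\<close>).  By (iv) the maximum of the scheme eventually lies above the
  threshold, so it is attained at a late index where the two sequences agree, and the same holds for
  \<open>X\<close>: the maxima coincide (\<open>eventually_partial_max_eq\<close>).  The records are the times at which the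
  maximum increases, so they coincide as well.
\<close>

section \<open>Partial maxima and records\<close>

lemma partial_max_ge: "1 \<le> k \<Longrightarrow> k \<le> n \<Longrightarrow> X k \<omega> \<le> partial_max X n \<omega>"
  unfolding partial_max_def by (intro Max_ge) auto

lemma partial_max_attained: "1 \<le> n \<Longrightarrow> \<exists>k. 1 \<le> k \<and> k \<le> n \<and> partial_max X n \<omega> = X k \<omega>"
proof -
  assume "1 \<le> n"
  then have "Max ((\<lambda>k. X k \<omega>) ` {1..n}) \<in> (\<lambda>k. X k \<omega>) ` {1..n}" by (intro Max_in) auto
  then show ?thesis unfolding partial_max_def by auto
qed

lemma borel_measurable_partial_max:
  assumes "\<And>k. 1 \<le> k \<Longrightarrow> X k \<in> borel_measurable M"
  shows "partial_max X n \<in> borel_measurable M"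
  unfolding partial_max_def[abs_def] using assms by (intro borel_measurable_Max) auto

lemma record_indicator_iff_partial_max_increases:
  assumes "2 \<le> n"
  shows "record_indicator X n \<omega> = (if partial_max X (n - 1) \<omega> < partial_max X n \<omega> then 1 else 0)"
proof -
  have "{1..n} = insert n {1..n - 1}" "{1..n - 1} \<noteq> {}" using assms by auto
  then have "partial_max X n \<omega> = max (X n \<omega>) (partial_max X (n - 1) \<omega>)"
    unfolding partial_max_def by simp
  then show ?thesis using assms by (simp add: record_indicator_def less_max_iff_disj)
qed

text \<open>
  The deterministic core.  An early value can no longer be a maximum once the scheme has exceeded it.
  The index at which a late maximum of \<open>y\<close> is attained is then late itself; since the maximum exceeds
  the threshold at time \<open>n\<close> and thresholds increase, it exceeds the threshold at that index as well,
  so \<open>x\<close> takes the same value there.  The same reasoning applies to \<open>x\<close>, once its maximum is known to be at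
  least that of \<open>y\<close>.
\<close>
lemma eventually_partial_max_eq:
  fixes x y :: "nat \<Rightarrow> real"
  defines "m \<equiv> partial_max (\<lambda>k z. z k)"
  assumes l: "mono_on {1..} l"
    and agree: "\<forall>\<^sub>F k in sequentially. l k < x k \<or> l k < y k \<longrightarrow> y k = x k"
    and above: "\<forall>\<^sub>F n in sequentially. l n < m n y"
    and beaten: "\<And>k. 1 \<le> k \<Longrightarrow> \<exists>n\<ge>1. x k < y n" "\<And>k. 1 \<le> k \<Longrightarrow> \<exists>n\<ge>1. y k < y n"
  shows "\<forall>\<^sub>F n in sequentially. m n x = m n y"
proof -
  obtain N where N: "\<And>k. N \<le> k \<Longrightarrow> l k < x k \<or> l k < y k \<Longrightarrow> y k = x k"
    using agree by (auto simp: eventually_sequentially)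
  have ev: "\<forall>\<^sub>F n in sequentially. v < m n y" if ex: "\<exists>n\<ge>1. v < y n" for v
  proof -
    obtain j where j: "1 \<le> j" "v < y j" using ex by auto
    show ?thesis
      using eventually_ge_at_top[of j]
    proof eventually_elim
      case (elim n)
      then show ?case using partial_max_ge[OF j(1) elim, of "\<lambda>k z. z k" y] j by (simp add: m_def)
    qed
  qed
  have "\<forall>\<^sub>F n in sequentially. \<forall>k\<in>{1..<N}. x k < m n y \<and> y k < m n y"
    using ev beaten by (intro eventually_ball_finite ballI eventually_conj) auto
  then show ?thesis
    using above eventually_ge_at_top[of 1]
  proof eventually_elim
    case (elim n)
    note early = elim(1) and above = elim(2) and n = elim(3)
    show ?case
    proof (rule antisym)
      obtain k where k: "1 \<le> k" "k \<le> n" "m n y = y k"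
        using partial_max_attained[OF n] unfolding m_def by metis
      have "N \<le> k" using early k by force
      moreover have "l k \<le> l n" using l k by (auto simp: mono_on_def)
      ultimately have "y k = x k" using above k(3) by (intro N) auto
      then show ge: "m n y \<le> m n x"
        using partial_max_ge[OF k(1,2), of "\<lambda>k z. z k" x] k(3) by (simp add: m_def)
      obtain j where j: "1 \<le> j" "j \<le> n" "m n x = x j"
        using partial_max_attained[OF n] unfolding m_def by metis
      have "N \<le> j" using early j ge by force
      moreover have "l j \<le> l n" using l j by (auto simp: mono_on_def)
      ultimately have "y j = x j" using above ge j(3) by (intro N) auto
      then show "m n x \<le> m n y"
        using partial_max_ge[OF j(1,2), of "\<lambda>k z. z k" y] j(3) by (simp add: m_def)
    qed
  qed
qed

text \<open>
  The time is one more than the last index at which the maxima differ, because the record indicator at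
  time \<open>n\<close> involves the maxima at times \<open>n - 1\<close> and \<open>n\<close>.
\<close>
lemma coupling_time:
  fixes X Y :: "nat \<Rightarrow> 'a \<Rightarrow> real"
  assumes X: "\<And>n. 1 \<le> n \<Longrightarrow> X n \<in> borel_measurable P"
    and Y: "\<And>n. 1 \<le> n \<Longrightarrow> Y n \<in> borel_measurable P"
    and ev: "AE p in P. \<forall>\<^sub>F n in sequentially. partial_max X n p = partial_max Y n p"
  obtains T :: "'a \<Rightarrow> enat" where "T \<in> measurable P (count_space UNIV)" "AE p in P. T p < \<infinity>"
    "\<And>p n. 1 \<le> n \<Longrightarrow> T p \<le> enat n \<Longrightarrow>
      (partial_max X n p, record_indicator X n p) = (partial_max Y n p, record_indicator Y n p)"
proof -
  define good where "good n p \<longleftrightarrow> (\<forall>m\<ge>n. partial_max X m p = partial_max Y m p)" for n p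
  define T where "T p = (if \<exists>n. good n p then enat (Suc (LEAST n. good n p)) else \<infinity>)" for p
  have [measurable]: "partial_max X m \<in> borel_measurable P" "partial_max Y m \<in> borel_measurable P" for m
    by (intro borel_measurable_partial_max X Y; assumption)+
  have good_meas[measurable]: "Measurable.pred P (good n)" for n
    unfolding good_def[abs_def] by measurable
  have least: "(\<lambda>p. LEAST n. good n p) \<in> measurable P (count_space UNIV)" by measurable
  have enat_least: "(\<lambda>p. enat (Suc (LEAST n. good n p))) \<in> measurable P (count_space UNIV)"
    by (rule measurable_compose[OF least]) simp
  have "Measurable.pred P (\<lambda>p. \<exists>n. good n p)" by measurable
  then have "T \<in> measurable P (count_space UNIV)"
    unfolding T_def[abs_def] by (intro measurable_If enat_least) (simp_all add: pred_def)
  moreover have "AE p in P. T p < \<infinity>"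
    using ev by eventually_elim (auto simp: T_def good_def eventually_sequentially)
  moreover have "(partial_max X n p, record_indicator X n p) = (partial_max Y n p, record_indicator Y n p)"
    if n: "1 \<le> n" and Tn: "T p \<le> enat n" for n p
  proof -
    have ex: "\<exists>n. good n p" using Tn by (auto simp: T_def split: if_splits)
    then have k: "T p = enat (Suc (LEAST n. good n p))" by (simp add: T_def)
    have "good (LEAST n. good n p) p" using ex by (rule LeastI_ex)
    moreover have "(LEAST n. good n p) < n" using Tn by (simp add: k)
    ultimately have eq: "partial_max X m p = partial_max Y m p" if "n \<le> Suc m" for m
      unfolding good_def[of "LEAST n. good n p"] using that by simp
    have "record_indicator X n p = record_indicator Y n p"
    proof (cases "n = 1")
      case True
      then show ?thesis by (simp add: record_indicator_def)
    next
      case False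
      then have "2 \<le> n" using n by simp
      moreover have "partial_max X (n - 1) p = partial_max Y (n - 1) p"
        using \<open>2 \<le> n\<close> by (intro eq) auto
      ultimately show ?thesis
        using eq[of n] by (simp only: record_indicator_iff_partial_max_increases)
    qed
    then show ?thesis using eq[of n] by simp
  qed
  ultimately show ?thesis by (rule that)
qed

section \<open>Distribution functions and their right endpoints\<close>

lemma is_df_bounds: "is_df G \<Longrightarrow> 0 \<le> G x" "is_df G \<Longrightarrow> G x \<le> 1"
  by (auto simp: is_df_def finite_borel_measure.cdf_nonneg real_distribution.finite_borel_measure_M real_distribution.cdf_bounded_prob)

lemma is_df_mono: "is_df G \<Longrightarrow> x \<le> y \<Longrightarrow> G x \<le> G y"
  by (auto simp: is_df_def intro!: finite_borel_measure.cdf_nondecreasing real_distribution.finite_borel_measure_M)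

lemma quantile_le_iff:
  assumes G: "is_df G" and u: "0 < u" "u < 1"
  shows "quantile G u \<le> x \<longleftrightarrow> u \<le> G x"
proof -
  obtain \<mu> where "real_distribution \<mu>" and G_eq: "G = cdf \<mu>" using G by (auto simp: is_df_def)
  interpret real_distribution \<mu> by fact
  have "eventually (\<lambda>y. u < G y) at_top"
    using cdf_lim_at_top_prob u(2) unfolding G_eq by (auto dest: order_tendstoD)
  then obtain y where "u < G y" by (auto simp: eventually_at_top_linorder)
  then have ne: "{x. u \<le> G x} \<noteq> {}" by (auto intro: less_imp_le)
  have "eventually (\<lambda>y. G y < u) at_bot"
    using cdf_lim_at_bot u(1) unfolding G_eq by (auto dest: order_tendstoD)
  then obtain b where b: "G b < u" by (auto simp: eventually_at_bot_linorder)
  have bdd: "bdd_below {x. u \<le> G x}"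
  proof (rule bdd_belowI)
    fix x assume "x \<in> {x. u \<le> G x}"
    then show "b \<le> x" using b is_df_mono[OF G, of x b] by (cases "x \<le> b") auto
  qed
  show ?thesis
  proof
    assume q: "quantile G u \<le> x"
    have "u \<le> G y" if "x < y" for y
    proof -
      have "Inf {x. u \<le> G x} < y" using q that by (simp add: quantile_def)
      then obtain z where "z < y" "u \<le> G z" using cInf_lessD[OF ne, of y] by auto
      then show ?thesis using is_df_mono[OF G, of z y] by simp
    qed
    then have "eventually (\<lambda>y. u \<le> G y) (at_right x)"
      by (auto simp: eventually_at_filter)
    moreover have "(G \<longlongrightarrow> G x) (at_right x)"
      using cdf_is_right_cont[of x] by (simp add: G_eq continuous_within)
    ultimately show "u \<le> G x" by (intro tendsto_lowerbound) auto
  next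
    assume "u \<le> G x"
    then show "quantile G u \<le> x" unfolding quantile_def using bdd by (intro cInf_lower) auto
  qed
qed

text \<open>
  The quantile function is monotone on \<open>(0, 1)\<close>, so its left limit at \<open>1\<close> exists in the extended reals
  and is a supremum.
\<close>
lemma right_endpoint_eq_SUP:
  assumes G: "is_df G"
  shows "right_endpoint G = (SUP u\<in>{0<..<1}. ereal (quantile G u))"
proof -
  have mono: "quantile G u \<le> quantile G v" if "0 < u" "u \<le> v" "v < 1" for u v
    using that quantile_le_iff[OF G, of v "quantile G v"] by (subst quantile_le_iff[OF G]) auto
  have "((\<lambda>u. ereal (quantile G u)) \<longlongrightarrow> (SUP u\<in>{0<..<1}. ereal (quantile G u))) (at_left 1)"
  proof (rule order_tendstoI)
    fix a assume "a < (SUP u\<in>{0<..<1}. ereal (quantile G u))"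
    then obtain u where u: "0 < u" "u < 1" "a < ereal (quantile G u)" by (auto simp: less_SUP_iff)
    have "eventually (\<lambda>v. v \<in> {u<..<1}) (at_left (1::real))"
      using u by (intro eventually_at_leftI[of u]) auto
    then show "eventually (\<lambda>u. a < ereal (quantile G u)) (at_left 1)"
      by eventually_elim (use u in \<open>auto intro!: less_le_trans[OF u(3)] mono\<close>)
  next
    fix a assume a: "(SUP u\<in>{0<..<1}. ereal (quantile G u)) < a"
    have "eventually (\<lambda>v. v \<in> {0<..<1}) (at_left (1::real))"
      by (intro eventually_at_leftI[of 0]) auto
    then show "eventually (\<lambda>u. ereal (quantile G u) < a) (at_left 1)"
    proof eventually_elim
      case (elim u)
      then have "ereal (quantile G u) \<le> (SUP u\<in>{0<..<1}. ereal (quantile G u))" by (rule SUP_upper)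
      then show ?case using a by (rule le_less_trans)
    qed
  qed
  then show ?thesis unfolding right_endpoint_def by (intro tendsto_Lim) auto
qed

lemma df_less_1_below_right_endpoint:
  assumes G: "is_df G" and x: "ereal x < right_endpoint G"
  shows "G x < 1"
proof -
  obtain u where u: "0 < u" "u < 1" "ereal x < ereal (quantile G u)"
    using x unfolding right_endpoint_eq_SUP[OF G] by (auto simp: less_SUP_iff)
  then have "\<not> u \<le> G x" by (simp flip: quantile_le_iff[OF G u(1,2)])
  then show ?thesis using u by simp
qed

lemma df_eq_1_at_right_endpoint:
  assumes G: "is_df G" and x: "right_endpoint G \<le> ereal x"
  shows "G x = 1"
proof (rule antisym)
  show "1 \<le> G x"
  proof (rule dense_le_bounded[of 0])
    fix u :: real assume u: "0 < u" "u < 1"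
    have "ereal (quantile G u) \<le> right_endpoint G"
      unfolding right_endpoint_eq_SUP[OF G] using u by (intro SUP_upper) auto
    then have "quantile G u \<le> x" using x by (metis ereal_less_eq(3) order_trans)
    then show "u \<le> G x" using u by (simp add: quantile_le_iff[OF G])
  qed simp
qed (use G in \<open>rule is_df_bounds\<close>)

lemma (in prob_space) AE_le_right_endpoint:
  assumes [measurable]: "Z \<in> borel_measurable M"
  shows "AE \<omega> in M. ereal (Z \<omega>) \<le> right_endpoint (df_of M Z)"
proof -
  have G: "is_df (df_of M Z)" 
    unfolding is_df_def df_of_def using real_distribution_distr[OF assms] by blast
  show ?thesis
  proof (cases "right_endpoint (df_of M Z)")
    case (real r)
    have "prob {\<omega> \<in> space M. Z \<omega> \<le> r} = df_of M Z r"
      unfolding df_of_def cdf_def by (subst measure_distr) (auto intro!: arg_cong[of _ _ prob])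
    then have "prob {\<omega> \<in> space M. Z \<omega> \<le> r} = 1"
      using df_eq_1_at_right_endpoint[OF G, of r] real by simp
    then have "AE \<omega> in M. Z \<omega> \<le> r" by (simp add: prob_Collect_eq_1)
    then show ?thesis by (simp add: real)
  next
    case MInf
    have "ereal (quantile (df_of M Z) (1/2)) \<le> right_endpoint (df_of M Z)"
      unfolding right_endpoint_eq_SUP[OF G] by (intro SUP_upper) auto
    then show ?thesis using MInf by simp
  qed simp
qed

text \<open>
  A continuous d.f. has no atom at the left end of the set where it equals \<open>1\<close>, and no mass beyond it.
\<close>
lemma (in real_distribution) AE_cdf_less_1:
  assumes cont: "continuous_on UNIV (cdf M)"
  shows "AE x in M. cdf M x < 1"
proof -
  define S where "S = {x. cdf M x = 1}"
  have S: "x \<in> S \<or> cdf M x < 1" for x using cdf_bounded_prob[of x] by (auto simp: S_def)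
  show ?thesis
  proof (cases "S = {}")
    case True then show ?thesis using S by auto
  next
    case False
    have "eventually (\<lambda>y. cdf M y < 1) at_bot"
      using cdf_lim_at_bot by (rule order_tendstoD) simp
    then obtain b where b: "\<And>y. y \<le> b \<Longrightarrow> cdf M y < 1" by (auto simp: eventually_at_bot_linorder)
    have bdd: "bdd_below S"
    proof (rule bdd_belowI)
      fix x assume "x \<in> S"
      then show "b \<le> x" using b[of x] by (cases "x \<le> b") (auto simp: S_def)
    qed
    have "closed S" unfolding S_def using cont by (intro closed_Collect_eq) auto
    then have r: "Inf S \<in> S" using False bdd by (intro closed_contains_Inf)
    define r where "r = Inf S"
    have "prob {..r} = 1" using r by (simp add: S_def r_def cdf_def)
    moreover have "prob {r} = 0"
      using cont by (simp flip: isCont_cdf add: continuous_on_eq_continuous_at)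
    moreover have "prob ({..r} - {r}) = prob {..r} - prob {r}" by (intro finite_measure_Diff) auto
    moreover have "{..r} - {r} = {..<r}" by auto
    ultimately have "prob {..<r} = 1" by simp
    then have "AE x in M. x \<in> {..<r}" by (subst (asm) prob_eq_1) auto
    then show ?thesis
    proof eventually_elim
      case (elim x)
      then have "x \<notin> S" using cInf_lower[OF _ bdd, of x] by (auto simp: r_def)
      then show ?case using S by auto
    qed
  qed
qed

lemma real_distribution_eq_interval_measure_cdf:
  assumes "real_distribution \<mu>"
  shows "interval_measure (cdf \<mu>) = \<mu>"
proof -
  interpret real_distribution \<mu> by fact
  show ?thesis
    by (intro cdf_unique assms real_distribution_interval_measure cdf_interval_measure cdf_nondecreasing
        cdf_is_right_cont cdf_lim_at_bot cdf_lim_at_top_prob)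
qed

lemma continuous_df_less_1_extend:
  fixes F :: "real \<Rightarrow> real"
  assumes "continuous_on UNIV F" "F v < 1"
  shows "\<exists>q\<in>\<rat>. v < q \<and> F q < 1"
proof -
  have "(F \<longlongrightarrow> F v) (at_right v)"
    using assms(1) by (auto simp: continuous_on_def intro: tendsto_within_subset)
  then have "eventually (\<lambda>q. F q < 1) (at_right v)"
    using assms(2) by (rule order_tendstoD)
  then obtain b where "v < b" "\<And>q. v < q \<Longrightarrow> q < b \<Longrightarrow> F q < 1"
    by (auto simp: eventually_at_right_field)
  then show ?thesis using Rats_dense_in_real[of v b] by blast
qed

text \<open>
  The marginals of an \<open>F\<^sup>\<alpha>\<close>-scheme are given by their d.f.s, which determine them; independence turns
  the joint law into a product.  In particular all \<open>F\<^sup>\<alpha>\<close>-schemes with the same \<open>F\<close> and \<open>\<alpha>\<close> have the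
  same law, so it suffices to construct one of them next to \<open>X\<close>.
\<close>
lemma falpha_scheme_law:
  assumes "falpha_scheme N Y F \<alpha>"
  shows "\<And>n. 1 \<le> n \<Longrightarrow> real_distribution (pow_distr F (\<alpha> n))"
    and "\<And>n. 1 \<le> n \<Longrightarrow> cdf (pow_distr F (\<alpha> n)) = (\<lambda>x. F x powr \<alpha> n)"
    and "seq_law N Y = PiM {1..} (\<lambda>n. pow_distr F (\<alpha> n))"
proof -
  note fal = assms[unfolded falpha_scheme_def]
  interpret N: prob_space N using fal by auto
  have distr: "distr N borel (Y n) = pow_distr F (\<alpha> n)"
    and real_distr: "real_distribution (pow_distr F (\<alpha> n))"
    and cdf_pow: "cdf (pow_distr F (\<alpha> n)) = (\<lambda>x. F x powr \<alpha> n)" if "1 \<le> n" for n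
  proof -
    have Yn: "Y n \<in> borel_measurable N" using fal that by (auto simp: N.indep_vars_def)
    have cdf: "cdf (distr N borel (Y n)) = (\<lambda>x. F x powr \<alpha> n)"
      using fal that by (auto simp: df_of_def)
    have rd: "real_distribution (distr N borel (Y n))" using Yn by simp
    show eq: "distr N borel (Y n) = pow_distr F (\<alpha> n)"
      unfolding pow_distr_def cdf[symmetric]
      by (rule real_distribution_eq_interval_measure_cdf[OF rd, symmetric])
    show "real_distribution (pow_distr F (\<alpha> n))" "cdf (pow_distr F (\<alpha> n)) = (\<lambda>x. F x powr \<alpha> n)"
      using rd cdf unfolding eq by auto
  qed
  show "real_distribution (pow_distr F (\<alpha> n))" "cdf (pow_distr F (\<alpha> n)) = (\<lambda>x. F x powr \<alpha> n)"
    if "1 \<le> n" for n using real_distr[OF that] cdf_pow[OF that] .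
  have "seq_law N Y = PiM {1..} (\<lambda>n. distr N borel (Y n))"
    unfolding seq_law_def using fal
    by (intro N.indep_vars_iff_distr_eq_PiM'[THEN iffD1]) (auto simp: N.indep_vars_def)
  also have "\<dots> = PiM {1..} (\<lambda>n. pow_distr F (\<alpha> n))" using distr by (intro PiM_cong) auto
  finally show "seq_law N Y = PiM {1..} (\<lambda>n. pow_distr F (\<alpha> n))" .
qed

text \<open>
  The probability that the first \<open>n\<close> variables all stay below \<open>x\<close> is \<open>c\<close> to the power
  \<open>\<alpha> 1 + \<dots> + \<alpha> n\<close>, which tends to \<open>0\<close>.
\<close>
lemma AE_exceeds_level:
  fixes \<nu> :: "nat \<Rightarrow> real measure" and \<alpha> :: "nat \<Rightarrow> real"
  assumes \<nu>: "\<And>n. 1 \<le> n \<Longrightarrow> real_distribution (\<nu> n)" "\<And>n. 1 \<le> n \<Longrightarrow> cdf (\<nu> n) x = c powr \<alpha> n"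
    and c: "0 \<le> c" "c < 1" and \<alpha>: "filterlim (\<lambda>n. \<Sum>k=1..n. \<alpha> k) at_top sequentially"
  shows "AE y in PiM {1..} \<nu>. \<exists>n\<ge>1. x < y n"
proof -
  interpret P: prob_space "PiM {1..} \<nu>"
    using \<nu>(1) by (intro prob_space_PiM) (auto simp: real_distribution_def)
  define Z where "Z n = prod_emb {1..} \<nu> {1..n} (\<Pi>\<^sub>E i\<in>{1..n}. {..x})" for n :: nat
  have Z_sets: "Z n \<in> sets (PiM {1..} \<nu>)" for n
    unfolding Z_def using \<nu>(1) by (intro sets_PiM_I) (auto simp: real_distribution.events_eq_borel)
  have Z: "emeasure (PiM {1..} \<nu>) (Z n) = ennreal (\<Prod>i=1..n. c powr \<alpha> i)" for n
  proof -
    have "emeasure (PiM {1..} \<nu>) (Z n) = (\<Prod>i=1..n. emeasure (\<nu> i) {..x})"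
      unfolding Z_def using \<nu>(1)
      by (intro emeasure_PiM_emb) (auto simp: real_distribution.events_eq_borel real_distribution_def)
    also have "\<dots> = (\<Prod>i=1..n. ennreal (c powr \<alpha> i))"
    proof (rule prod.cong)
      fix i assume "i \<in> {1..n}"
      then interpret real_distribution "\<nu> i" using \<nu>(1) by auto
      show "emeasure (\<nu> i) {..x} = ennreal (c powr \<alpha> i)"
        using \<nu>(2)[of i] \<open>i \<in> {1..n}\<close> by (simp add: cdf_def emeasure_eq_measure)
    qed simp
    also have "\<dots> = ennreal (\<Prod>i=1..n. c powr \<alpha> i)" by (intro prod_ennreal) auto
    finally show ?thesis .
  qed
  have "(\<lambda>n. \<Prod>i=1..n. c powr \<alpha> i) \<longlonglongrightarrow> 0"
  proof (cases "c = 0")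
    case True
    have "eventually (\<lambda>n. (\<Prod>i=1..n. c powr \<alpha> i) = 0) sequentially"
      using eventually_ge_at_top[of 1] by eventually_elim (auto simp: True)
    then show ?thesis by (rule tendsto_eventually)
  next
    case False
    have "filterlim (\<lambda>n. ln c * (\<Sum>k=1..n. \<alpha> k)) at_bot sequentially"
      using False c by (intro filterlim_tendsto_neg_mult_at_bot[OF tendsto_const _ \<alpha>]) (auto simp: ln_less_zero)
    then have "(\<lambda>n. exp (ln c * (\<Sum>k=1..n. \<alpha> k))) \<longlonglongrightarrow> 0"
      by (rule filterlim_compose[OF exp_at_bot])
    moreover have "(\<Prod>i=1..n. c powr \<alpha> i) = exp (ln c * (\<Sum>k=1..n. \<alpha> k))" for n
      using False powr_sum[of c \<alpha> "{1..n}"] by (simp add: powr_def[of _ "sum _ _"] mult.commute)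
    ultimately show ?thesis by simp
  qed
  then have lim: "(\<lambda>n. emeasure (PiM {1..} \<nu>) (Z n)) \<longlonglongrightarrow> 0"
    unfolding Z using tendsto_ennrealI by (metis ennreal_0)
  have "(\<Inter>n. Z n) \<in> null_sets (PiM {1..} \<nu>)"
  proof (rule null_setsI)
    have "emeasure (PiM {1..} \<nu>) (\<Inter>n. Z n) \<le> emeasure (PiM {1..} \<nu>) (Z n)" for n
      using Z_sets by (intro emeasure_mono) auto
    then have "emeasure (PiM {1..} \<nu>) (\<Inter>n. Z n) \<le> 0"
      by (intro LIMSEQ_le_const[OF lim]) blast
    then show "emeasure (PiM {1..} \<nu>) (\<Inter>n. Z n) = 0" by simp
    show "(\<Inter>n. Z n) \<in> sets (PiM {1..} \<nu>)" using Z_sets by auto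
  qed
  then show ?thesis
    by (rule AE_I') (auto simp: Z_def prod_emb_def space_PiM PiE_iff Pi_iff extensional_def not_less)
qed

section \<open>Thinning one distribution into another above a threshold\<close>

text \<open>
  The supremum in the definition of \<open>tv_on\<close> is over sums that are at most \<open>2\<close>, the two measures having
  total mass \<open>1\<close>; the partition that consists of \<open>B\<close> alone then gives the bound.
\<close>
lemma abs_measure_diff_le_tv_on:
  assumes "prob_space \<mu>" "prob_space \<nu>" "sets \<mu> = sets borel" "sets \<nu> = sets borel"
    and B: "B \<in> sets borel" "B \<subseteq> A"
  shows "\<bar>measure \<mu> B - measure \<nu> B\<bar> \<le> tv_on A \<mu> \<nu>"
proof -
  interpret \<mu>: prob_space \<mu> by fact
  interpret \<nu>: prob_space \<nu> by fact
  let ?S = "{P. finite P \<and> disjoint P \<and> P \<subseteq> sets borel \<and> \<Union>P \<subseteq> A}"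
  have "(\<Sum>C\<in>P. \<bar>measure \<mu> C - measure \<nu> C\<bar>) \<le> 2" if P: "P \<in> ?S" for P
  proof -
    have "(\<Sum>C\<in>P. \<bar>measure \<mu> C - measure \<nu> C\<bar>) \<le> (\<Sum>C\<in>P. measure \<mu> C + measure \<nu> C)"
      by (intro sum_mono) (auto simp: abs_le_iff intro: order_trans[of _ 0] add_nonneg_nonneg)
    also have "\<dots> = measure \<mu> (\<Union>P) + measure \<nu> (\<Union>P)"
      using P assms(3,4) \<mu>.finite_measure_finite_Union[of P "\<lambda>x. x"]
        \<nu>.finite_measure_finite_Union[of P "\<lambda>x. x"]
      by (auto simp: sum.distrib disjoint_family_on_def disjoint_def)
    also have "\<dots> \<le> 2"
      using add_mono[OF \<mu>.prob_le_1[of "\<Union>P"] \<nu>.prob_le_1[of "\<Union>P"]] by simp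
    finally show ?thesis .
  qed
  then have "bdd_above ((\<lambda>P. \<Sum>C\<in>P. \<bar>measure \<mu> C - measure \<nu> C\<bar>) ` ?S)"
    by (intro bdd_aboveI[of _ 2]) auto
  moreover have "{B} \<in> ?S"
    using B by auto
  ultimately show ?thesis
    unfolding tv_on_def using cSUP_upper[of "{B}" ?S "\<lambda>P. \<Sum>C\<in>P. \<bar>measure \<mu> C - measure \<nu> C\<bar>"]
    by simp
qed

text \<open>
  Applied to \<open>{x. 1 < f x}\<close>, the hypothesis bounds the integral of \<open>f\<close> over this set by its measure.  So
  the integral of \<open>f - 1 > 0\<close> over it vanishes, and it is a null set.
\<close>
lemma AE_density_le_1:
  assumes "finite_measure \<mu>" and f[measurable]: "f \<in> borel_measurable \<mu>"
    and le: "\<And>A. A \<in> sets \<mu> \<Longrightarrow> emeasure (density \<mu> f) A \<le> emeasure \<mu> A"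
  shows "AE x in \<mu>. f x \<le> (1 :: ennreal)"
proof -
  interpret finite_measure \<mu> by fact
  define D where "D = {x \<in> space \<mu>. 1 < f x}"
  have [measurable]: "D \<in> sets \<mu>" by (simp add: D_def)
  have "(\<integral>\<^sup>+x. (f x - 1) * indicator D x \<partial>\<mu>) + emeasure \<mu> D
      = (\<integral>\<^sup>+x. (f x - 1) * indicator D x + indicator D x \<partial>\<mu>)"
    by (simp add: nn_integral_add)
  also have "\<dots> = (\<integral>\<^sup>+x. f x * indicator D x \<partial>\<mu>)"
    by (intro nn_integral_cong) (auto simp: D_def diff_add_cancel_ennreal less_imp_le split: split_indicator)
  also have "\<dots> = emeasure (density \<mu> f) D"
    by (simp add: emeasure_density)
  also have "\<dots> \<le> 0 + emeasure \<mu> D"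
    using le[of D] by simp
  finally have "(\<integral>\<^sup>+x. (f x - 1) * indicator D x \<partial>\<mu>) = 0"
    by (subst (asm) add.commute, subst (asm) (2) add.commute)
       (auto simp: ennreal_add_left_cancel_le)
  then have "AE x in \<mu>. (f x - 1) * indicator D x = 0"
    by (subst (asm) nn_integral_0_iff_AE) auto
  with AE_space show ?thesis
    by eventually_elim (auto simp: D_def not_less diff_eq_0_iff_ennreal split: split_indicator_asm)
qed

text \<open>
  Above \<open>l\<close>, a Hahn decomposition separates a set \<open>Y\<close> on which \<open>\<nu>\<close> is dominated by \<open>\<mu>\<close> from the rest, on
  which \<open>\<mu>\<close> is dominated by \<open>\<nu>\<close>.  The common part of the two distributions is \<open>\<nu>\<close> on \<open>Y\<close> and \<open>\<mu>\<close> off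
  \<open>Y\<close>.  What \<open>\<mu>\<close> (or \<open>\<nu>\<close>) has above \<open>l\<close> in excess of it is the difference of the two measures on the
  single set \<open>Y\<close> (or on its complement), hence at most their total variation distance.  With respect to
  \<open>\<mu>\<close> the common part has a density \<open>k\<close> between \<open>0\<close> and \<open>1\<close>, which can serve as a probability of
  acceptance.
\<close>
lemma overlap_density:
  assumes "prob_space \<mu>" "prob_space \<nu>" and sets_mu[measurable_cong]: "sets \<mu> = sets borel"
    and sets_nu[measurable_cong]: "sets \<nu> = sets borel"
  obtains k :: "real \<Rightarrow> real" where "k \<in> borel_measurable borel" "\<And>x. 0 \<le> k x" "\<And>x. k x \<le> 1"
    "\<And>x. x \<le> l \<Longrightarrow> k x = 0"
    "\<And>B. B \<in> sets borel \<Longrightarrow> emeasure (density \<mu> k) B \<le> emeasure \<nu> B"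
    "measure \<mu> {l<..} \<le> measure (density \<mu> k) UNIV + tv_on {l<..} \<mu> \<nu>"
    "measure \<nu> {l<..} \<le> measure (density \<mu> k) UNIV + tv_on {l<..} \<mu> \<nu>"
proof -
  interpret \<mu>: prob_space \<mu> by fact
  interpret \<nu>: prob_space \<nu> by fact
  have "\<exists>Y\<in>sets \<mu>. Y \<subseteq> {l<..} \<and> (\<forall>C\<in>sets \<mu>. C \<subseteq> Y \<longrightarrow> emeasure \<nu> C \<le> emeasure \<mu> C) \<and>
      (\<forall>C\<in>sets \<mu>. C \<subseteq> {l<..} \<longrightarrow> C \<inter> Y = {} \<longrightarrow> emeasure \<mu> C \<le> emeasure \<nu> C)"
    by (rule unsigned_Hahn_decomposition) (simp_all add: sets_mu sets_nu)
  then obtain Y where "Y \<in> sets \<mu>" and YL: "Y \<subseteq> {l<..}"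
    and le_Y: "\<And>C. C \<in> sets \<mu> \<Longrightarrow> C \<subseteq> Y \<Longrightarrow> emeasure \<nu> C \<le> emeasure \<mu> C"
    and le_Y': "\<And>C. C \<in> sets \<mu> \<Longrightarrow> C \<subseteq> {l<..} \<Longrightarrow> C \<inter> Y = {} \<Longrightarrow> emeasure \<mu> C \<le> emeasure \<nu> C"
    by auto
  have Y[measurable]: "Y \<in> sets borel"
    using \<open>Y \<in> sets \<mu>\<close> by (simp add: sets_mu)
  note le_Y = le_Y[unfolded sets_mu]
  have le_cY: "emeasure \<mu> C \<le> emeasure \<nu> C" if "C \<in> sets borel" "C \<subseteq> {l<..} - Y" for C
    using that by (intro le_Y') (auto simp: sets_mu)
  let ?nY = "density \<nu> (indicator Y)"
  have nY: "emeasure ?nY A = emeasure \<nu> (A \<inter> Y)" if [measurable]: "A \<in> sets borel" for A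
    by (simp add: emeasure_density Int_commute flip: indicator_inter_arith)
  have "finite_measure ?nY"
    by (intro finite_measureI) (simp add: nY sets_eq_imp_space_eq[OF sets_nu])
  moreover have "absolutely_continuous \<mu> ?nY"
    unfolding absolutely_continuous_def
  proof
    fix N assume N: "N \<in> null_sets \<mu>"
    then have [measurable]: "N \<in> sets borel" by (auto simp: sets_mu)
    have "emeasure \<nu> (N \<inter> Y) \<le> emeasure \<mu> (N \<inter> Y)" by (intro le_Y) auto
    also have "\<dots> \<le> emeasure \<mu> N" by (intro emeasure_mono) (auto simp: sets_mu)
    finally show "N \<in> null_sets ?nY" using N by (auto simp: null_sets_def nY sets_nu)
  qed
  ultimately obtain f where f: "f \<in> borel_measurable \<mu>" and df: "density \<mu> f = ?nY"
    using \<mu>.Radon_Nikodym_finite_measure[of ?nY] by (auto simp: sets_mu sets_nu)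
  have [measurable]: "f \<in> borel_measurable borel" using f by simp
  have "AE x in \<mu>. f x \<le> 1"
  proof (rule AE_density_le_1[OF \<mu>.finite_measure_axioms f])
    fix A assume "A \<in> sets \<mu>"
    then have [measurable]: "A \<in> sets borel" by (simp add: sets_mu)
    have "emeasure \<nu> (A \<inter> Y) \<le> emeasure \<mu> (A \<inter> Y)" by (intro le_Y) auto
    also have "\<dots> \<le> emeasure \<mu> A" by (intro emeasure_mono) (auto simp: sets_mu)
    finally show "emeasure (density \<mu> f) A \<le> emeasure \<mu> A" by (simp add: df nY)
  qed
  note f_le = this
  \<comment> \<open>truncation at \<open>1\<close> changes \<open>f\<close> on a null set only, and makes the bound hold everywhere\<close>
  define k where "k x = (if x \<in> Y then enn2real (min 1 (f x)) else indicator {l<..} x)" for x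
  have k_meas[measurable]: "k \<in> borel_measurable borel" unfolding k_def by measurable
  have k: "0 \<le> k x" "k x \<le> 1" for x
    unfolding k_def by (auto simp: enn2real_leI split: split_indicator)
  have m: "emeasure (density \<mu> k) B = emeasure \<nu> (B \<inter> Y) + emeasure \<mu> (B \<inter> ({l<..} - Y))"
    if [measurable]: "B \<in> sets borel" for B
  proof -
    have "emeasure (density \<mu> k) B = (\<integral>\<^sup>+x. ennreal (k x) * indicator B x \<partial>\<mu>)"
      by (simp add: emeasure_density)
    also have "\<dots> = (\<integral>\<^sup>+x. f x * indicator (B \<inter> Y) x + indicator (B \<inter> ({l<..} - Y)) x \<partial>\<mu>)"
      using f_le by (intro nn_integral_cong_AE, eventually_elim)
        (auto simp: k_def min_def ennreal_enn2real_if top_unique split: split_indicator)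
    also have "\<dots> = emeasure (density \<mu> f) (B \<inter> Y) + emeasure \<mu> (B \<inter> ({l<..} - Y))"
      by (simp add: nn_integral_add emeasure_density)
    finally show ?thesis by (simp add: df nY)
  qed
  have mU: "measure (density \<mu> k) UNIV = measure \<nu> Y + measure \<mu> ({l<..} - Y)"
    unfolding measure_def using m[of UNIV]
    by (simp add: enn2real_plus less_top[symmetric])
  note tv = abs_measure_diff_le_tv_on[OF assms(1,2) sets_mu sets_nu, of _ "{l<..}"]
  show ?thesis
  proof (rule that[OF k_meas k])
    show "k x = 0" if "x \<le> l" for x
      using that YL by (auto simp: k_def)
    show "emeasure (density \<mu> k) B \<le> emeasure \<nu> B" if [measurable]: "B \<in> sets borel" for B
    proof -
      have "emeasure (density \<mu> k) B \<le> emeasure \<nu> (B \<inter> Y) + emeasure \<nu> (B \<inter> ({l<..} - Y))"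
        unfolding m[OF that] by (intro add_left_mono le_cY) auto
      also have "\<dots> = emeasure \<nu> (B \<inter> {l<..})"
        using YL by (subst plus_emeasure) (auto intro!: arg_cong[of _ _ "emeasure \<nu>"])
      also have "\<dots> \<le> emeasure \<nu> B" by (intro emeasure_mono) auto
      finally show ?thesis .
    qed
    show "measure \<mu> {l<..} \<le> measure (density \<mu> k) UNIV + tv_on {l<..} \<mu> \<nu>"
      using tv[OF Y YL] \<mu>.finite_measure_Diff[of "{l<..}" Y] YL unfolding mU by auto
    show "measure \<nu> {l<..} \<le> measure (density \<mu> k) UNIV + tv_on {l<..} \<mu> \<nu>"
      using tv[of "{l<..} - Y"] \<nu>.finite_measure_Diff[of "{l<..}" Y] YL unfolding mU by auto
  qed
qed

text \<open>
  \<open>R\<close> is the normalized difference of \<open>\<nu>\<close> and the subprobability measure \<open>m\<close>; if \<open>m\<close> has mass \<open>1\<close>,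
  there is nothing to normalize and any distribution serves.
\<close>
lemma residual_distribution:
  assumes "prob_space \<nu>" "finite_measure m" and sets_m: "sets m = sets \<nu>"
    and le: "\<And>B. B \<in> sets \<nu> \<Longrightarrow> emeasure m B \<le> emeasure \<nu> B"
  obtains R where "prob_space R" "sets R = sets \<nu>"
    "\<And>B. B \<in> sets \<nu> \<Longrightarrow> emeasure \<nu> B = emeasure m B + (1 - emeasure m (space \<nu>)) * emeasure R B"
proof -
  interpret \<nu>: prob_space \<nu> by fact
  interpret m: finite_measure m by fact
  define c where "c = 1 - emeasure m (space \<nu>)"
  define D where "D = diff_measure \<nu> m"
  have sD: "sets D = sets \<nu>" by (simp add: D_def)
  have D: "emeasure D B = emeasure \<nu> B - emeasure m B" if "B \<in> sets \<nu>" for B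
    unfolding D_def using that le sets_m
    by (intro emeasure_diff_measure) (auto intro: \<nu>.finite_measure_axioms m.finite_measure_axioms)
  have eq: "emeasure \<nu> B = emeasure m B + emeasure D B" if "B \<in> sets \<nu>" for B
    using le[OF that] that by (simp add: D add_diff_inverse_ennreal)
  have Ds: "emeasure D (space \<nu>) = c"
    by (simp add: D c_def \<nu>.emeasure_space_1)
  have cfin: "c < top" unfolding c_def by (simp add: less_top[symmetric])
  show ?thesis
  proof (cases "c = 0")
    case True
    have "emeasure D B = 0" if "B \<in> sets \<nu>" for B
      using emeasure_mono[of B "space \<nu>" D] that Ds True sD sets.sets_into_space[OF that] by auto
    then show ?thesis
      using True eq by (intro that[of \<nu>]) (auto simp: c_def assms)
  next
    case False
    define R where "R = scale_measure (1 / c) D"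
    have sR: "sets R = sets \<nu>" "space R = space \<nu>"
      by (simp_all add: R_def sD space_scale_measure sets_eq_imp_space_eq[OF sD])
    have cR: "c * emeasure R B = emeasure D B" for B
      using False cfin
      by (simp add: R_def ennreal_times_divide mult.assoc[symmetric] ennreal_divide_self)
    have "prob_space R"
      by (rule prob_spaceI) (use False cfin in \<open>simp add: R_def sR space_scale_measure sets_eq_imp_space_eq[OF sD] Ds ennreal_divide_times ennreal_divide_self\<close>)
    then show ?thesis
      using eq cR by (intro that[of R]) (auto simp: sR c_def)
  qed
qed

text \<open>
  A randomized map that turns a variable with law \<open>\<mu>\<close> into one with law \<open>\<nu>\<close>, the randomness being a
  further variable \<open>z\<close> with law \<open>Q\<close>.  It ignores where below \<open>l\<close> its argument lies, and it rarely
  changes anything above \<open>l\<close>.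
\<close>
definition threshold_kernel ::
  "real \<Rightarrow> real measure \<Rightarrow> real measure \<Rightarrow> 'c measure \<Rightarrow> (real \<Rightarrow> 'c \<Rightarrow> real) \<Rightarrow> bool" where
  "threshold_kernel l \<mu> \<nu> Q \<phi> \<longleftrightarrow>
     prob_space Q \<and> (\<lambda>(x, z). \<phi> x z) \<in> borel_measurable (borel \<Otimes>\<^sub>M Q) \<and>
     (\<forall>x. \<phi> (max x l) = \<phi> x) \<and>
     (\<forall>B\<in>sets borel. (\<integral>\<^sup>+x. emeasure Q {z \<in> space Q. \<phi> x z \<in> B} \<partial>\<mu>) = emeasure \<nu> B) \<and>
     measure (\<mu> \<Otimes>\<^sub>M Q) {p \<in> space (\<mu> \<Otimes>\<^sub>M Q). (l < fst p \<or> l < \<phi> (fst p) (snd p)) \<and>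
        \<phi> (fst p) (snd p) \<noteq> fst p} \<le> 2 * tv_on {l<..} \<mu> \<nu>"

text \<open>
  The randomness is a pair of a uniform variable, which accepts \<open>x > l\<close> with probability \<open>k x\<close>, and a
  draw from the residual distribution, which is the output after a rejection.  Input and output
  differ only after a rejection.  The mass above \<open>l\<close> of the input, and likewise of the output, that
  belongs to rejections is its total mass above \<open>l\<close> less that of the common part.
\<close>
lemma threshold_kernel_exists:
  assumes "prob_space \<mu>" "prob_space \<nu>" and sets_mu[measurable_cong]: "sets \<mu> = sets borel"
    and sets_nu[measurable_cong]: "sets \<nu> = sets borel"
  shows "\<exists>(Q :: (real \<times> real) measure) \<phi>. threshold_kernel l \<mu> \<nu> Q \<phi>"
proof -
  interpret \<mu>: prob_space \<mu> by fact
  interpret \<nu>: prob_space \<nu> by fact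
  have sp: "space \<mu> = UNIV" "space \<nu> = UNIV"
    using sets_eq_imp_space_eq[OF sets_mu] sets_eq_imp_space_eq[OF sets_nu] by auto
  obtain k :: "real \<Rightarrow> real" where k_meas[measurable]: "k \<in> borel_measurable borel"
    and k: "\<And>x. 0 \<le> k x" "\<And>x. k x \<le> 1" "\<And>x. x \<le> l \<Longrightarrow> k x = 0"
    and k_le: "\<And>B. B \<in> sets borel \<Longrightarrow> emeasure (density \<mu> k) B \<le> emeasure \<nu> B"
    and k_mu: "measure \<mu> {l<..} \<le> measure (density \<mu> k) UNIV + tv_on {l<..} \<mu> \<nu>"
    and k_nu: "measure \<nu> {l<..} \<le> measure (density \<mu> k) UNIV + tv_on {l<..} \<mu> \<nu>"
    by (rule overlap_density[OF assms, of l], rule that)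
  define m where "m = density \<mu> k"
  have fin_m: "finite_measure m"
    using k_le[of UNIV] \<nu>.emeasure_finite[of UNIV]
    by (intro finite_measureI) (auto simp: m_def sp top_unique)
  interpret m: finite_measure m by fact
  have m_k: "emeasure m B = (\<integral>\<^sup>+x. ennreal (k x) * indicator B x \<partial>\<mu>)" if "B \<in> sets borel" for B
    unfolding m_def using that by (subst emeasure_density) (auto simp: sets_mu)
  obtain R where "prob_space R" and sets_R[measurable_cong]: "sets R = sets borel"
    and R: "\<And>B. B \<in> sets borel \<Longrightarrow> emeasure \<nu> B = emeasure m B + (1 - emeasure m UNIV) * emeasure R B"
    using residual_distribution[OF \<open>prob_space \<nu>\<close> fin_m] k_le by (auto simp: m_def sp sets_mu sets_nu)
  interpret R: prob_space R by fact
  define U :: "real measure" where "U = uniform_measure lborel {0..1}"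
  have sets_U[measurable_cong]: "sets U = sets borel" by (simp add: U_def)
  interpret U: prob_space U
    unfolding U_def by (intro prob_space_uniform_measure) auto
  interpret UR: pair_prob_space U R ..
  define Q where "Q = U \<Otimes>\<^sub>M R"
  have sets_Q[measurable_cong]: "sets Q = sets (borel \<Otimes>\<^sub>M borel)"
    unfolding Q_def by (intro sets_pair_measure_cong sets_U sets_R)
  have spQ: "space Q = UNIV" using sets_eq_imp_space_eq[OF sets_Q] by (simp add: space_pair_measure)
  interpret Q: prob_space Q unfolding Q_def by (rule UR.prob_space_axioms)
  interpret \<mu>Q: pair_prob_space \<mu> Q ..
  define \<phi> where "\<phi> x z = (if l < x \<and> fst z < k x then x else snd z)" for x and z :: "real \<times> real"
  have \<phi>_meas: "(\<lambda>(x, z). \<phi> x z) \<in> borel_measurable (borel \<Otimes>\<^sub>M Q)"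
  proof -
    have "(\<lambda>p. if l < fst p \<and> fst (snd p) < k (fst p) then fst p else snd (snd p))
        \<in> borel_measurable (borel \<Otimes>\<^sub>M (borel \<Otimes>\<^sub>M borel))" by measurable
    also have "borel_measurable (borel \<Otimes>\<^sub>M (borel \<Otimes>\<^sub>M borel)) = borel_measurable (borel \<Otimes>\<^sub>M Q)"
      by (intro measurable_cong_sets sets_pair_measure_cong) (simp_all add: sets_Q)
    finally show ?thesis by (simp add: \<phi>_def case_prod_beta')
  qed
  have U_less: "emeasure U {u. u < a} = a" "emeasure U {u. \<not> u < a} = 1 - ennreal a"
    if "0 \<le> a" "a \<le> 1" for a
  proof -
    have "{0..1} \<inter> {u. u < a} = {0..<a}" "{0..1} \<inter> {u. \<not> u < a} = {a..1}" using that by auto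
    moreover have "b * inverse (ennreal 1) = b" for b by simp
    ultimately show "emeasure U {u. u < a} = a" "emeasure U {u. \<not> u < a} = 1 - ennreal a"
      using that by (auto simp: U_def ennreal_minus divide_ennreal_def ennreal_1[symmetric] simp del: ennreal_1)
  qed
  have acc: "emeasure Q {z. (l < x \<and> fst z < k x) \<and> x \<in> B} = ennreal (k x) * indicator B x"
    if [measurable]: "B \<in> sets borel" for x B
  proof (cases "l < x \<and> x \<in> B")
    case True
    then have "{z. (l < x \<and> fst z < k x) \<and> x \<in> B} = {u. u < k x} \<times> UNIV" by auto
    then have "emeasure Q {z. (l < x \<and> fst z < k x) \<and> x \<in> B} = emeasure Q ({u. u < k x} \<times> UNIV)"
      by (rule arg_cong)
    also have "emeasure Q ({u. u < k x} \<times> UNIV) = emeasure U {u. u < k x} * emeasure R UNIV"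
      unfolding Q_def by (intro R.emeasure_pair_measure_Times) auto
    finally show ?thesis using True U_less(1)[of "k x"] k R.emeasure_space_1
      by (simp add: sets_eq_imp_space_eq[OF sets_R])
  next
    case False
    then have "{z. (l < x \<and> fst z < k x) \<and> x \<in> B} = {}" by auto
    then show ?thesis using False k(3)[of x] by (auto simp: not_less split: split_indicator)
  qed
  have rej: "emeasure Q {z. \<not> (l < x \<and> fst z < k x) \<and> snd z \<in> B} = (1 - ennreal (k x)) * emeasure R B"
    if [measurable]: "B \<in> sets borel" for x B
  proof -
    have "{z. \<not> (l < x \<and> fst z < k x) \<and> snd z \<in> B} = (if l < x then {u. \<not> u < k x} else UNIV) \<times> B"
      by auto
    then have "emeasure Q {z. \<not> (l < x \<and> fst z < k x) \<and> snd z \<in> B}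
        = emeasure Q ((if l < x then {u. \<not> u < k x} else UNIV) \<times> B)"
      by (rule arg_cong)
    also have "emeasure Q ((if l < x then {u. \<not> u < k x} else UNIV) \<times> B)
        = emeasure U (if l < x then {u. \<not> u < k x} else UNIV) * emeasure R B"
      unfolding Q_def by (intro R.emeasure_pair_measure_Times) auto
    also have "emeasure U (if l < x then {u. \<not> u < k x} else UNIV) = 1 - ennreal (k x)"
      using U_less(2)[of "k x"] k U.emeasure_space_1 k(3)[of x]
      by (auto simp: sets_eq_imp_space_eq[OF sets_U] not_less)
    finally show ?thesis .
  qed
  have int_k: "(\<integral>\<^sup>+x. 1 - ennreal (k x) \<partial>\<mu>) = 1 - emeasure m UNIV"
  proof -
    have "(\<integral>\<^sup>+x. 1 - ennreal (k x) \<partial>\<mu>) = (\<integral>\<^sup>+x. 1 \<partial>\<mu>) - (\<integral>\<^sup>+x. ennreal (k x) \<partial>\<mu>)"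
      using k m.emeasure_finite[of UNIV] m_k[of UNIV]
      by (intro nn_integral_diff) (auto simp: top_unique)
    then show ?thesis using m_k[of UNIV] \<mu>.emeasure_space_1 by simp
  qed
  have law: "(\<integral>\<^sup>+x. emeasure Q {z \<in> space Q. \<phi> x z \<in> B} \<partial>\<mu>) = emeasure \<nu> B"
    if [measurable]: "B \<in> sets borel" for B
  proof -
    have "emeasure Q {z \<in> space Q. \<phi> x z \<in> B}
        = ennreal (k x) * indicator B x + (1 - ennreal (k x)) * emeasure R B" for x
    proof -
      have "emeasure Q {z \<in> space Q. \<phi> x z \<in> B} = emeasure Q ({z. (l < x \<and> fst z < k x) \<and> x \<in> B} \<union>
          {z. \<not> (l < x \<and> fst z < k x) \<and> snd z \<in> B})"
        by (intro arg_cong[of _ _ "emeasure Q"]) (auto simp: spQ \<phi>_def)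
      also have "\<dots> = emeasure Q {z. (l < x \<and> fst z < k x) \<and> x \<in> B} +
          emeasure Q {z. \<not> (l < x \<and> fst z < k x) \<and> snd z \<in> B}"
      proof (rule plus_emeasure[symmetric])
        have "{z \<in> space Q. (l < x \<and> fst z < k x) \<and> x \<in> B} \<in> sets Q"
          "{z \<in> space Q. \<not> (l < x \<and> fst z < k x) \<and> snd z \<in> B} \<in> sets Q"
          by measurable
        then show "{z. (l < x \<and> fst z < k x) \<and> x \<in> B} \<in> sets Q"
          "{z. \<not> (l < x \<and> fst z < k x) \<and> snd z \<in> B} \<in> sets Q" by (simp_all add: spQ)
      qed auto
      finally show ?thesis by (simp only: acc[OF that] rej[OF that])
    qed
    then have "(\<integral>\<^sup>+x. emeasure Q {z \<in> space Q. \<phi> x z \<in> B} \<partial>\<mu>)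
        = (\<integral>\<^sup>+x. ennreal (k x) * indicator B x + (1 - ennreal (k x)) * emeasure R B \<partial>\<mu>)" by simp
    also have "\<dots> = emeasure m B + (1 - emeasure m UNIV) * emeasure R B"
      by (subst nn_integral_add) (simp_all add: m_k nn_integral_multc int_k)
    finally show ?thesis using R[of B] by simp
  qed
  \<comment> \<open>the event of acceptance, on which input and output coincide and lie above \<open>l\<close>\<close>
  define E where "E = {p \<in> space (\<mu> \<Otimes>\<^sub>M Q). l < fst p \<and> fst (snd p) < k (fst p)}"
  have E[measurable]: "E \<in> sets (\<mu> \<Otimes>\<^sub>M Q)" unfolding E_def by measurable
  have "emeasure (\<mu> \<Otimes>\<^sub>M Q) E = (\<integral>\<^sup>+x. emeasure Q {z. (l < x \<and> fst z < k x) \<and> x \<in> UNIV} \<partial>\<mu>)"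
    by (subst Q.emeasure_pair_measure_alt[OF E])
       (auto intro!: nn_integral_cong arg_cong[of _ _ "emeasure Q"] simp: E_def space_pair_measure sp spQ)
  also have "\<dots> = emeasure m UNIV" by (subst acc, simp) (simp add: m_k)
  finally have measE: "measure (\<mu> \<Otimes>\<^sub>M Q) E = measure m UNIV" by (simp add: measure_def)
  define A1 where "A1 = {p \<in> space (\<mu> \<Otimes>\<^sub>M Q). l < fst p}"
  define A2 where "A2 = {p \<in> space (\<mu> \<Otimes>\<^sub>M Q). l < (case p of (x, z) \<Rightarrow> \<phi> x z)}"
  have A1[measurable]: "A1 \<in> sets (\<mu> \<Otimes>\<^sub>M Q)" unfolding A1_def by measurable
  have \<phi>_meas'[measurable]: "(\<lambda>(x, z). \<phi> x z) \<in> borel_measurable (\<mu> \<Otimes>\<^sub>M Q)"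
    using \<phi>_meas by (simp cong: measurable_cong_sets add: sets_mu)
  have A2[measurable]: "A2 \<in> sets (\<mu> \<Otimes>\<^sub>M Q)" unfolding A2_def by measurable
  have "emeasure (\<mu> \<Otimes>\<^sub>M Q) A1 = emeasure (\<mu> \<Otimes>\<^sub>M Q) ({l<..} \<times> UNIV)"
    by (intro arg_cong[of _ _ "emeasure _"]) (auto simp: A1_def space_pair_measure sp spQ)
  also have "\<dots> = emeasure \<mu> {l<..}"
    using Q.emeasure_space_1 sets.top[of Q] by (subst Q.emeasure_pair_measure_Times) (auto simp: spQ sets_Q)
  finally have measA1: "measure (\<mu> \<Otimes>\<^sub>M Q) A1 = measure \<mu> {l<..}" by (simp add: measure_def)
  have "emeasure (\<mu> \<Otimes>\<^sub>M Q) A2 = (\<integral>\<^sup>+x. emeasure Q {z \<in> space Q. \<phi> x z \<in> {l<..}} \<partial>\<mu>)"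
    by (subst Q.emeasure_pair_measure_alt[OF A2])
       (auto intro!: nn_integral_cong arg_cong[of _ _ "emeasure Q"] simp: A2_def space_pair_measure sp spQ)
  also have "\<dots> = emeasure \<nu> {l<..}" by (intro law) auto
  finally have measA2: "measure (\<mu> \<Otimes>\<^sub>M Q) A2 = measure \<nu> {l<..}" by (simp add: measure_def)
  have "measure (\<mu> \<Otimes>\<^sub>M Q) {p \<in> space (\<mu> \<Otimes>\<^sub>M Q). (l < fst p \<or> l < \<phi> (fst p) (snd p)) \<and>
        \<phi> (fst p) (snd p) \<noteq> fst p} \<le> measure (\<mu> \<Otimes>\<^sub>M Q) ((A1 - E) \<union> (A2 - E))"
    by (intro \<mu>Q.finite_measure_mono) (auto simp: A1_def A2_def E_def \<phi>_def split: if_splits)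
  also have "\<dots> \<le> measure (\<mu> \<Otimes>\<^sub>M Q) (A1 - E) + measure (\<mu> \<Otimes>\<^sub>M Q) (A2 - E)"
    by (intro measure_Un_le) auto
  also have "\<dots> = (measure \<mu> {l<..} - measure m UNIV) + (measure \<nu> {l<..} - measure m UNIV)"
    unfolding measE[symmetric] measA1[symmetric] measA2[symmetric]
    by (intro arg_cong2[of _ _ _ _ "(+)"] \<mu>Q.finite_measure_Diff)
       (auto simp: A1_def A2_def E_def \<phi>_def)
  also have "\<dots> \<le> 2 * tv_on {l<..} \<mu> \<nu>"
    using k_mu k_nu unfolding m_def by simp
  finally have bad: "measure (\<mu> \<Otimes>\<^sub>M Q) {p \<in> space (\<mu> \<Otimes>\<^sub>M Q). (l < fst p \<or> l < \<phi> (fst p) (snd p)) \<and>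
        \<phi> (fst p) (snd p) \<noteq> fst p} \<le> 2 * tv_on {l<..} \<mu> \<nu>" .
  have "\<phi> (max x l) = \<phi> x" for x by (auto simp: \<phi>_def fun_eq_iff max_def)
  then have "threshold_kernel l \<mu> \<nu> Q \<phi>"
    unfolding threshold_kernel_def using Q.prob_space_axioms \<phi>_meas law bad by blast
  then show ?thesis by blast
qed

lemma measurable_kernel_prob:
  assumes "prob_space Q" and \<phi>: "(\<lambda>(x, z). \<phi> x z) \<in> borel_measurable (borel \<Otimes>\<^sub>M Q)"
    and A: "A \<in> sets borel"
  shows "(\<lambda>x. emeasure Q {z \<in> space Q. \<phi> x z \<in> A}) \<in> borel_measurable borel"
proof -
  interpret Q: prob_space Q by fact
  let ?Z = "(\<lambda>(x, z). \<phi> x z) -` A \<inter> space (borel \<Otimes>\<^sub>M Q)"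
  have "?Z \<in> sets (borel \<Otimes>\<^sub>M Q)" using \<phi> A by (rule measurable_sets)
  then have "(\<lambda>x. emeasure Q (Pair x -` ?Z)) \<in> borel_measurable borel"
    by (rule Q.measurable_emeasure_Pair)
  also have "(\<lambda>x. emeasure Q (Pair x -` ?Z)) = (\<lambda>x. emeasure Q {z \<in> space Q. \<phi> x z \<in> A})"
    by (auto simp: fun_eq_iff space_pair_measure intro!: arg_cong[of _ _ "emeasure Q"])
  finally show ?thesis .
qed

section \<open>Independence above the thresholds\<close>

text \<open>
  Since the conditional d.f. of \<open>X n\<close> given the past agrees with its d.f. on \<open>[l n, \<infinity>)\<close>, the variable
  \<open>max (X n) (l n)\<close>, whose d.f. vanishes below \<open>l n\<close>, is independent of the past.  The earlier
  clipped variables are functions of the past, and joint independence follows by induction.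
\<close>
lemma (in prob_space) indep_vars_max_threshold:
  fixes X :: "nat \<Rightarrow> 'a \<Rightarrow> real" and l :: "nat \<Rightarrow> real"
  assumes X[measurable]: "\<And>n. 1 \<le> n \<Longrightarrow> X n \<in> borel_measurable M"
    and cond: "\<And>n. 2 \<le> n \<Longrightarrow> \<exists>G. conditional_df M X n G \<and>
        (\<forall>x\<in>space (PiM {1..<n} (\<lambda>_. borel)). \<forall>y\<ge>l n. G x y = df_of M (X n) y)"
  shows "indep_vars (\<lambda>_. borel) (\<lambda>n \<omega>. max (X n \<omega>) (l n)) {1..}"
proof -
  define W where "W n \<omega> = max (X n \<omega>) (l n)" for n \<omega>
  have W[measurable]: "W n \<in> borel_measurable M" if "1 \<le> n" for n
    unfolding W_def[abs_def] using X[OF that] by measurable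
  have step: "prob {\<omega> \<in> space M. \<omega> \<in> E \<and> W n \<omega> \<in> A} = prob E * prob {\<omega> \<in> space M. W n \<omega> \<in> A}"
    if n: "2 \<le> n" and B: "B \<in> sets (PiM {1..<n} (\<lambda>_. borel))"
      and E: "E = {\<omega> \<in> space M. (\<lambda>k\<in>{1..<n}. X k \<omega>) \<in> B}" and A: "A \<in> sets borel" for n B E A
  proof -
    define S :: "(nat \<Rightarrow> real) measure" where "S = PiM {1..<n} (\<lambda>_. borel)"
    define past where "past \<omega> = (\<lambda>k\<in>{1..<n}. X k \<omega>)" for \<omega>
    have Xn[measurable]: "X n \<in> borel_measurable M" "W n \<in> borel_measurable M" using n by auto
    have past[measurable]: "past \<in> measurable M S"
      unfolding past_def[abs_def] S_def by (intro measurable_restrict) auto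
    have BS[measurable]: "B \<in> sets S" using B by (simp add: S_def)
    have EM[measurable]: "E \<in> sets M" unfolding E past_def[symmetric] by measurable
    obtain G where G: "conditional_df M X n G"
      and Gl: "\<forall>x\<in>space S. \<forall>y\<ge>l n. G x y = df_of M (X n) y"
      using cond[OF n] unfolding S_def by auto
    have above: "prob {\<omega> \<in> space M. \<omega> \<in> E \<and> X n \<omega> \<le> y} = prob E * df_of M (X n) y" if y: "l n \<le> y" for y
    proof -
      have "prob {\<omega> \<in> space M. \<omega> \<in> E \<and> X n \<omega> \<le> y} = prob {\<omega> \<in> space M. past \<omega> \<in> B \<and> X n \<omega> \<le> y}"
        by (intro arg_cong[of _ _ prob]) (auto simp: E past_def)
      also have "\<dots> = (LINT x:B|distr M S past. G x y)"
        using G BS unfolding conditional_df_def Let_def S_def past_def[abs_def] by blast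
      also have "\<dots> = (LINT x:B|distr M S past. df_of M (X n) y)"
        using Gl y sets.sets_into_space[OF BS]
        by (intro set_lebesgue_integral_cong) auto
      also have "\<dots> = measure (distr M S past) B * df_of M (X n) y"
        by (simp add: set_lebesgue_integral_def)
      also have "measure (distr M S past) B = prob E"
        by (subst measure_distr) (auto simp: E past_def intro!: arg_cong[of _ _ prob])
      finally show ?thesis .
    qed
    \<comment> \<open>the product rule extends from half-lines to Borel sets, both sides being finite measures\<close>
    define m1 where "m1 = distr (density M (indicator E)) borel (W n)"
    define m2 where "m2 = scale_measure (emeasure M E) (distr M borel (W n))"
    have e1: "emeasure m1 C = emeasure M {\<omega> \<in> space M. \<omega> \<in> E \<and> W n \<omega> \<in> C}" if [measurable]: "C \<in> sets borel" for C
      unfolding m1_def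
      by (subst emeasure_distr)
        (auto simp: emeasure_density nn_integral_indicator simp flip: indicator_inter_arith
          intro!: arg_cong[of _ _ "emeasure M"])
    have e2: "emeasure m2 C = emeasure M E * emeasure M {\<omega> \<in> space M. W n \<omega> \<in> C}" if [measurable]: "C \<in> sets borel" for C
      unfolding m2_def by (auto simp: emeasure_distr intro!: arg_cong2[of _ _ _ _ "(*)"] arg_cong[of _ _ "emeasure M"])
    have "m1 = m2"
    proof (rule cdf_unique')
      have "finite_measure m1" "finite_measure m2"
        using e1[of UNIV] e2[of UNIV]
        by (auto intro!: finite_measureI simp: m1_def[THEN arg_cong[of _ _ space]]
          m2_def[THEN arg_cong[of _ _ space]] space_scale_measure ennreal_mult_eq_top_iff)
      moreover have "sets m1 = sets borel" "sets m2 = sets borel" by (auto simp: m1_def m2_def)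
      ultimately show "finite_borel_measure m1" "finite_borel_measure m2"
        by (auto simp: finite_borel_measure_def finite_borel_measure_axioms_def)
      show "cdf m1 = cdf m2"
      proof
        fix y
        have "prob {\<omega> \<in> space M. \<omega> \<in> E \<and> W n \<omega> \<le> y} = prob E * prob {\<omega> \<in> space M. W n \<omega> \<le> y}"
        proof (cases "l n \<le> y")
          case True
          then have "{\<omega> \<in> space M. \<omega> \<in> E \<and> W n \<omega> \<le> y} = {\<omega> \<in> space M. \<omega> \<in> E \<and> X n \<omega> \<le> y}"
            "{\<omega> \<in> space M. W n \<omega> \<le> y} = {\<omega> \<in> space M. X n \<omega> \<le> y}" by (auto simp: W_def)
          moreover have "df_of M (X n) y = prob {\<omega> \<in> space M. X n \<omega> \<le> y}"
            unfolding df_of_def cdf_def by (subst measure_distr) (auto intro!: arg_cong[of _ _ prob])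
          ultimately show ?thesis using above[OF True] by simp
        next
          case False
          then have "{\<omega> \<in> space M. \<omega> \<in> E \<and> W n \<omega> \<le> y} = {}" "{\<omega> \<in> space M. W n \<omega> \<le> y} = {}"
            by (auto simp: W_def)
          then show ?thesis by (simp only: measure_empty mult_zero_right)
        qed
        then show "cdf m1 y = cdf m2 y"
          using e1[of "{..y}"] e2[of "{..y}"]
          by (simp add: cdf_def measure_def enn2real_mult)
      qed
    qed
    then show ?thesis
      using e1[OF A] e2[OF A] by (simp add: measure_def flip: enn2real_mult)
  qed
  have prod: "prob {\<omega> \<in> space M. \<forall>k\<in>{1..n}. W k \<omega> \<in> A k} = (\<Prod>k\<in>{1..n}. prob {\<omega> \<in> space M. W k \<omega> \<in> A k})"
    if A: "\<And>k. A k \<in> sets borel" for A :: "nat \<Rightarrow> real set" and n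
  proof (induction n)
    case 0
    then show ?case by (simp add: prob_space)
  next
    case (Suc n)
    show ?case
    proof (cases "n = 0")
      case True
      then show ?thesis by simp
    next
      case False
      have [measurable]: "A k \<in> sets borel" for k by (rule A)
      define B where "B = {x \<in> space (PiM {1..<Suc n} (\<lambda>_. borel :: real measure)). \<forall>k\<in>{1..<Suc n}. max (x k) (l k) \<in> A k}"
      have B: "B \<in> sets (PiM {1..<Suc n} (\<lambda>_. borel))"
        unfolding B_def by measurable
      define E where "E = {\<omega> \<in> space M. (\<lambda>k\<in>{1..<Suc n}. X k \<omega>) \<in> B}"
      have E': "E = {\<omega> \<in> space M. \<forall>k\<in>{1..n}. W k \<omega> \<in> A k}"
        by (auto simp: E_def B_def space_PiM W_def)
      have "{\<omega> \<in> space M. \<forall>k\<in>{1..Suc n}. W k \<omega> \<in> A k} = {\<omega> \<in> space M. \<omega> \<in> E \<and> W (Suc n) \<omega> \<in> A (Suc n)}"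
        by (auto simp: E' atLeastAtMostSuc_conv)
      also have "prob \<dots> = prob E * prob {\<omega> \<in> space M. W (Suc n) \<omega> \<in> A (Suc n)}"
        using False by (intro step[OF _ B E_def]) auto
      finally show ?thesis using Suc.IH by (simp add: E')
    qed
  qed
  show ?thesis
    unfolding W_def[symmetric, abs_def] indep_vars_def2
  proof (intro conjI ballI indep_setsI)
    show "W i \<in> borel_measurable M" if "i \<in> {1..}" for i
      using W that by simp
    show "{W i -` A \<inter> space M | A. A \<in> sets borel} \<subseteq> events" if "i \<in> {1..}" for i
      using measurable_sets[OF W, of i] that by auto
    fix A :: "nat \<Rightarrow> 'a set" and J :: "nat set"
    assume J: "J \<noteq> {}" "J \<subseteq> {1..}" "finite J"
      and "\<forall>j\<in>J. A j \<in> {W j -` A \<inter> space M | A. A \<in> sets borel}"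
    then have "\<forall>j\<in>J. \<exists>C. C \<in> sets borel \<and> A j = W j -` C \<inter> space M" by auto
    then obtain C where C: "\<And>j. j \<in> J \<Longrightarrow> C j \<in> sets borel" "\<And>j. j \<in> J \<Longrightarrow> A j = W j -` C j \<inter> space M"
      by metis
    define C' where "C' j = (if j \<in> J then C j else UNIV)" for j
    obtain n where "\<forall>j\<in>J. j \<le> n" using J(3) finite_nat_set_iff_bounded_le by blast
    then have n: "J \<subseteq> {1..n}" using J(2) by auto
    have "\<omega> \<in> (\<Inter>j\<in>J. A j) \<longleftrightarrow> \<omega> \<in> space M \<and> (\<forall>k\<in>{1..n}. W k \<omega> \<in> C' k)" for \<omega>
    proof -
      have "\<omega> \<in> (\<Inter>j\<in>J. A j) \<longleftrightarrow> (\<forall>j\<in>J. \<omega> \<in> space M \<and> W j \<omega> \<in> C j)"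
        unfolding INT_iff by (intro ball_cong refl) (simp add: C(2) conj_commute)
      also have "\<dots> \<longleftrightarrow> \<omega> \<in> space M \<and> (\<forall>j\<in>J. W j \<omega> \<in> C j)" using J(1) by blast
      also have "(\<forall>j\<in>J. W j \<omega> \<in> C j) \<longleftrightarrow> (\<forall>k\<in>{1..n}. W k \<omega> \<in> C' k)"
        unfolding C'_def using subsetD[OF n] by (metis UNIV_I)
      finally show ?thesis .
    qed
    then have "prob (\<Inter>j\<in>J. A j) = prob {\<omega> \<in> space M. \<forall>k\<in>{1..n}. W k \<omega> \<in> C' k}"
      by (intro arg_cong[of _ _ prob] set_eqI) simp
    also have "\<dots> = (\<Prod>k\<in>{1..n}. prob {\<omega> \<in> space M. W k \<omega> \<in> C' k})"
      by (rule prod) (simp add: C'_def C(1))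
    also have "\<dots> = (\<Prod>k\<in>J. prob {\<omega> \<in> space M. W k \<omega> \<in> C' k})"
    proof (rule prod.mono_neutral_right)
      show "\<forall>k\<in>{1..n} - J. prob {\<omega> \<in> space M. W k \<omega> \<in> C' k} = 1"
        by (simp add: C'_def prob_space)
    qed (use n in simp_all)
    also have "\<dots> = (\<Prod>j\<in>J. prob (A j))"
    proof (rule prod.cong[OF refl])
      fix j assume "j \<in> J"
      then have "{\<omega> \<in> space M. W j \<omega> \<in> C' j} = A j"
        unfolding C(2)[OF \<open>j \<in> J\<close>] C'_def by auto
      then show "prob {\<omega> \<in> space M. W j \<omega> \<in> C' j} = prob (A j)" by simp
    qed
    finally show "prob (\<Inter>j\<in>J. A j) = (\<Prod>j\<in>J. prob (A j))" .
  qed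
qed

text \<open>
  Applying to each of a family of independent variables a randomized map of its own, with independent
  randomness, gives independent variables.  Given \<open>\<omega>\<close>, the probability of a cylinder factorizes;
  each factor depends on \<open>\<omega>\<close> only through one \<open>W i\<close>, so the expectation factorizes too.
\<close>
lemma (in prob_space) distr_independent_randomization:
  fixes W :: "'i \<Rightarrow> 'a \<Rightarrow> real" and Q :: "'i \<Rightarrow> 'c measure" and \<phi> :: "'i \<Rightarrow> real \<Rightarrow> 'c \<Rightarrow> real"
  assumes indep: "indep_vars (\<lambda>_. borel) W I"
    and Q: "\<And>i. i \<in> I \<Longrightarrow> prob_space (Q i)"
    and \<phi>: "\<And>i. i \<in> I \<Longrightarrow> (\<lambda>(x, z). \<phi> i x z) \<in> borel_measurable (borel \<Otimes>\<^sub>M Q i)"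
    and \<nu>: "\<And>i. i \<in> I \<Longrightarrow> prob_space (\<nu> i)" "\<And>i. i \<in> I \<Longrightarrow> sets (\<nu> i) = sets borel"
    and law: "\<And>i B. i \<in> I \<Longrightarrow> B \<in> sets borel \<Longrightarrow>
      (\<integral>\<^sup>+\<omega>. emeasure (Q i) {z \<in> space (Q i). \<phi> i (W i \<omega>) z \<in> B} \<partial>M) = emeasure (\<nu> i) B"
  shows "distr (M \<Otimes>\<^sub>M PiM I Q) (PiM I (\<lambda>_. borel)) (\<lambda>p. \<lambda>i\<in>I. \<phi> i (W i (fst p)) (snd p i)) = PiM I \<nu>"
proof (rule measure_eqI_PiM_infinite[symmetric, OF refl])
  let ?S = "PiM I (\<lambda>_. borel) :: ('i \<Rightarrow> real) measure"
  let ?\<Phi> = "\<lambda>p. \<lambda>i\<in>I. \<phi> i (W i (fst p)) (snd p i)"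
  interpret P: prob_space "PiM I Q" using Q by (intro prob_space_PiM)
  have W[measurable]: "W i \<in> borel_measurable M" if "i \<in> I" for i
    using indep that by (auto simp: indep_vars_def)
  have coord: "(\<lambda>p. \<phi> i (W i (fst p)) (snd p i)) \<in> borel_measurable (M \<Otimes>\<^sub>M PiM I Q)" if [measurable]: "i \<in> I" for i
  proof -
    have "(\<lambda>p. (W i (fst p), snd p i)) \<in> measurable (M \<Otimes>\<^sub>M PiM I Q) (borel \<Otimes>\<^sub>M Q i)"
      by measurable
    from measurable_compose[OF this \<phi>[OF that]] show ?thesis by simp
  qed
  have \<Phi>: "?\<Phi> \<in> measurable (M \<Otimes>\<^sub>M PiM I Q) ?S"
    by (intro measurable_restrict coord)
  have sets_eq: "sets (PiM I \<nu>) = sets ?S" using \<nu>(2) by (intro sets_PiM_cong) auto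
  then show "sets (distr (M \<Otimes>\<^sub>M PiM I Q) ?S ?\<Phi>) = sets (PiM I \<nu>)" by simp
  show "finite_measure (PiM I \<nu>)"
    using prob_space_PiM[of I \<nu>] \<nu>(1) by (auto simp: prob_space_def)
  fix A J assume J: "finite J" "J \<subseteq> I" and A: "\<And>i. i \<in> J \<Longrightarrow> A i \<in> sets (\<nu> i)"
  have A': "A i \<in> sets borel" if "i \<in> J" for i using A[OF that] \<nu>(2) J that by auto
  define g where "g i x = emeasure (Q i) {z \<in> space (Q i). \<phi> i x z \<in> A i}" for i x
  have g_sets: "{z \<in> space (Q i). \<phi> i x z \<in> A i} \<in> sets (Q i)" if "i \<in> J" for i x
  proof -
    have [measurable]: "\<phi> i x \<in> borel_measurable (Q i)"
      using measurable_compose[OF measurable_Pair1'[of x borel "Q i"] \<phi>[of i]] that J by auto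
    have [measurable]: "A i \<in> sets borel" using A'[OF that] .
    show ?thesis by measurable
  qed
  have g: "g i \<in> borel_measurable borel" if "i \<in> J" for i
    unfolding g_def using that J Q \<phi> A' by (intro measurable_kernel_prob) auto
  have cyl: "prod_emb I \<nu> J (Pi\<^sub>E J A) = {x \<in> space ?S. \<forall>i\<in>J. x i \<in> A i}"
    using J \<nu>(2)[THEN sets_eq_imp_space_eq] by (auto simp: prod_emb_def space_PiM PiE_iff Pi_iff extensional_def)
  define Z where "Z = {p \<in> space (M \<Otimes>\<^sub>M PiM I Q). \<forall>i\<in>J. \<phi> i (W i (fst p)) (snd p i) \<in> A i}"
  have cyl_sets: "prod_emb I \<nu> J (Pi\<^sub>E J A) \<in> sets ?S"
    using J A sets_eq by (auto intro!: sets_PiM_I)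
  have Z_eq: "?\<Phi> -` prod_emb I \<nu> J (Pi\<^sub>E J A) \<inter> space (M \<Otimes>\<^sub>M PiM I Q) = Z"
    using J by (auto simp: cyl Z_def space_PiM Pi_iff)
  then have Z: "Z \<in> sets (M \<Otimes>\<^sub>M PiM I Q)" using measurable_sets[OF \<Phi> cyl_sets] by simp
  have "emeasure (distr (M \<Otimes>\<^sub>M PiM I Q) ?S ?\<Phi>) (prod_emb I \<nu> J (Pi\<^sub>E J A)) = emeasure (M \<Otimes>\<^sub>M PiM I Q) Z"
    by (subst emeasure_distr[OF \<Phi> cyl_sets]) (simp only: Z_eq)
  also have "\<dots> = (\<integral>\<^sup>+\<omega>. emeasure (PiM I Q) (Pair \<omega> -` Z) \<partial>M)"
    by (rule P.emeasure_pair_measure_alt[OF Z])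
  also have "\<dots> = (\<integral>\<^sup>+\<omega>. (\<Prod>i\<in>J. g i (W i \<omega>)) \<partial>M)"
  proof (rule nn_integral_cong)
    fix \<omega> assume "\<omega> \<in> space M"
    then have "Pair \<omega> -` Z = prod_emb I Q J (\<Pi>\<^sub>E i\<in>J. {z \<in> space (Q i). \<phi> i (W i \<omega>) z \<in> A i})"
      by (auto simp: Z_def space_pair_measure prod_emb_def space_PiM PiE_iff Pi_iff extensional_def)
        (use J(2) in blast)
    then show "emeasure (PiM I Q) (Pair \<omega> -` Z) = (\<Prod>i\<in>J. g i (W i \<omega>))"
      using J Q g_sets by (simp add: emeasure_PiM_emb g_def)
  qed
  also have "\<dots> = (\<Prod>i\<in>J. \<integral>\<^sup>+\<omega>. g i (W i \<omega>) \<partial>M)"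
  proof (rule indep_vars_nn_integral[OF J(1)])
    show "indep_vars (\<lambda>_. borel) (\<lambda>i \<omega>. g i (W i \<omega>)) J"
      by (rule indep_vars_compose2[OF indep_vars_subset[OF indep J(2)] g])
  qed simp
  also have "\<dots> = (\<Prod>i\<in>J. emeasure (\<nu> i) (A i))"
    using law A' J by (intro prod.cong) (auto simp: g_def)
  also have "\<dots> = emeasure (PiM I \<nu>) (prod_emb I \<nu> J (Pi\<^sub>E J A))"
    using \<nu>(1) J A by (intro emeasure_PiM_emb[symmetric]) auto
  finally show "emeasure (PiM I \<nu>) (prod_emb I \<nu> J (Pi\<^sub>E J A)) =
      emeasure (distr (M \<Otimes>\<^sub>M PiM I Q) ?S ?\<Phi>) (prod_emb I \<nu> J (Pi\<^sub>E J A))" ..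
qed

section \<open>The coupling\<close>

lemma distr_fst_pair_prob:
  assumes "prob_space M" "prob_space Q"
  shows "distr (M \<Otimes>\<^sub>M Q) M fst = M"
proof (rule measure_eqI)
  interpret M: prob_space M by fact
  interpret Q: prob_space Q by fact
  fix A assume "A \<in> sets (distr (M \<Otimes>\<^sub>M Q) M fst)"
  then have A: "A \<in> sets M" by simp
  then have "fst -` A \<inter> space (M \<Otimes>\<^sub>M Q) = A \<times> space Q"
    using sets.sets_into_space[OF A] by (auto simp: space_pair_measure)
  then show "emeasure (distr (M \<Otimes>\<^sub>M Q) M fst) A = emeasure M A"
    using A by (simp add: emeasure_distr Q.emeasure_pair_measure_Times Q.emeasure_space_1)
qed simp

theorem theorem1:
  fixes M :: "'a measure" and X :: "nat \<Rightarrow> 'a \<Rightarrow> real"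
    and N :: "'b measure" and Y :: "nat \<Rightarrow> 'b \<Rightarrow> real"
    and F :: "real \<Rightarrow> real" and \<alpha> l :: "nat \<Rightarrow> real"
  assumes "threshold_falpha_scheme M X F \<alpha> l"
    and "falpha_scheme N Y F \<alpha>"
    and "no_atom_at_right_endpoint M X F"
  shows "\<exists>(P :: ((nat \<Rightarrow> real) \<times> (nat \<Rightarrow> real)) measure) X' Y' (T :: _ \<Rightarrow> enat).
    prob_space P \<and>
    (\<forall>n\<ge>1. X' n \<in> borel_measurable P) \<and> (\<forall>n\<ge>1. Y' n \<in> borel_measurable P) \<and>
    seq_law P X' = seq_law M X \<and> seq_law P Y' = seq_law N Y \<and>
    T \<in> measurable P (count_space UNIV) \<and> (AE \<omega> in P. T \<omega> < \<infinity>) \<and>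
    (\<forall>\<omega>\<in>space P. \<forall>n\<ge>1. T \<omega> \<le> enat n \<longrightarrow>
       (partial_max X' n \<omega>, record_indicator X' n \<omega>) =
       (partial_max Y' n \<omega>, record_indicator Y' n \<omega>))"
proof -
  note thr = assms(1)[unfolded threshold_falpha_scheme_def]
  interpret M: prob_space M using thr by auto
  have X[measurable]: "X n \<in> borel_measurable M" if "1 \<le> n" for n using thr that by auto
  have F: "is_df F" and contF: "continuous_on UNIV F" using thr by auto
  have l: "mono_on {1..} l" using thr by auto
  define \<nu> where "\<nu> n = pow_distr F (\<alpha> n)" for n
  have \<nu>: "real_distribution (\<nu> n)" and cdf_\<nu>: "cdf (\<nu> n) = (\<lambda>x. F x powr \<alpha> n)" if "1 \<le> n" for n
    using falpha_scheme_law(1,2)[OF assms(2) that] by (auto simp: \<nu>_def)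
  have law_Y: "seq_law N Y = PiM {1..} \<nu>"
    using falpha_scheme_law(3)[OF assms(2)] by (simp add: \<nu>_def[abs_def])
  have prob_\<nu>: "prob_space (\<nu> n)" and sets_\<nu>: "sets (\<nu> n) = sets borel" if "1 \<le> n" for n
    using \<nu>[OF that] by (auto simp: real_distribution_def real_distribution.events_eq_borel)
  define S :: "(nat \<Rightarrow> real) measure" where "S = PiM {1..} (\<lambda>_. borel)"
  define \<mu> where "\<mu> n = distr M borel (X n)" for n
  have prob_\<mu>: "prob_space (\<mu> n)" if "1 \<le> n" for n
    unfolding \<mu>_def using X[OF that] by (rule M.prob_space_distr)
  have "\<exists>(Q :: (real \<times> real) measure) \<phi>. 1 \<le> n \<longrightarrow> threshold_kernel (l n) (\<mu> n) (\<nu> n) Q \<phi>" for n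
    using threshold_kernel_exists[OF prob_\<mu>[of n] prob_\<nu>[of n] _ sets_\<nu>[of n], of "l n"]
    by (auto simp: \<mu>_def)
  then obtain Q :: "nat \<Rightarrow> (real \<times> real) measure" and \<phi>
    where "\<And>n. 1 \<le> n \<longrightarrow> threshold_kernel (l n) (\<mu> n) (\<nu> n) (Q n) (\<phi> n)" by metis
  then have kernel: "threshold_kernel (l n) (\<mu> n) (\<nu> n) (Q n) (\<phi> n)" if "1 \<le> n" for n using that by auto
  have Q: "prob_space (Q n)" and \<phi>: "(\<lambda>(x, z). \<phi> n x z) \<in> borel_measurable (borel \<Otimes>\<^sub>M Q n)"
    and \<phi>_max: "\<And>x. \<phi> n (max x (l n)) = \<phi> n x" if "1 \<le> n" for n
    using kernel[OF that] by (auto simp: threshold_kernel_def)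

  \<comment> \<open>the original probability space, enlarged by independent randomness for each index\<close>
  define R where "R = PiM {1..} Q"
  interpret R: prob_space R unfolding R_def using Q by (intro prob_space_PiM) auto
  interpret MR: pair_prob_space M R ..
  define xs where "xs p = (\<lambda>n\<in>{1..}. X n (fst p))" for p :: "'a \<times> (nat \<Rightarrow> real \<times> real)"
  define ys where "ys p = (\<lambda>n\<in>{1..}. \<phi> n (X n (fst p)) (snd p n))" for p :: "'a \<times> (nat \<Rightarrow> real \<times> real)"
  have proj: "(\<lambda>p. (X n (fst p), snd p n)) \<in> measurable (M \<Otimes>\<^sub>M R) (borel \<Otimes>\<^sub>M Q n)" if [measurable]: "1 \<le> n" for n
  proof -
    have [measurable]: "X n \<in> borel_measurable M" using X[OF that] .
    have [measurable]: "n \<in> {1..}" using that by simp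
    show ?thesis unfolding R_def by measurable
  qed
  have xs: "xs \<in> measurable (M \<Otimes>\<^sub>M R) S"
    unfolding xs_def[abs_def] S_def
    by (intro measurable_restrict measurable_compose[OF measurable_fst X]) auto
  have ys: "ys \<in> measurable (M \<Otimes>\<^sub>M R) S"
    unfolding ys_def[abs_def] S_def
  proof (intro measurable_restrict)
    fix n :: nat assume "n \<in> {1..}"
    then have "1 \<le> n" by simp
    from measurable_compose[OF proj[OF this] \<phi>[OF this]]
    show "(\<lambda>p. \<phi> n (X n (fst p)) (snd p n)) \<in> borel_measurable (M \<Otimes>\<^sub>M R)" by simp
  qed
  have law_xs: "distr (M \<Otimes>\<^sub>M R) S xs = seq_law M X"
  proof -
    have X_seq: "(\<lambda>\<omega>. \<lambda>n\<in>{1..}. X n \<omega>) \<in> measurable M S"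
      unfolding S_def by (intro measurable_restrict X) auto
    have "distr (M \<Otimes>\<^sub>M R) S xs = distr (distr (M \<Otimes>\<^sub>M R) M fst) S (\<lambda>\<omega>. \<lambda>n\<in>{1..}. X n \<omega>)"
      by (subst distr_distr[OF X_seq measurable_fst]) (simp add: xs_def[abs_def] comp_def)
    also have "distr (M \<Otimes>\<^sub>M R) M fst = M"
      by (intro distr_fst_pair_prob M.prob_space_axioms R.prob_space_axioms)
    finally show ?thesis unfolding seq_law_def S_def .
  qed
  have law_ys: "distr (M \<Otimes>\<^sub>M R) S ys = PiM {1..} \<nu>"
  proof -
    \<comment> \<open>the kernels see \<open>X n\<close> only through \<open>max (X n) (l n)\<close>, and these variables are independent\<close>
    have "distr (M \<Otimes>\<^sub>M PiM {1..} Q) (PiM {1..} (\<lambda>_. borel))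
        (\<lambda>p. \<lambda>n\<in>{1..}. \<phi> n (max (X n (fst p)) (l n)) (snd p n)) = PiM {1..} \<nu>"
    proof (rule M.distr_independent_randomization[OF M.indep_vars_max_threshold])
      fix n B assume "n \<in> {1::nat..}" and B: "B \<in> sets (borel :: real measure)"
      then have n: "1 \<le> n" by simp
      have "(\<integral>\<^sup>+\<omega>. emeasure (Q n) {z \<in> space (Q n). \<phi> n (max (X n \<omega>) (l n)) z \<in> B} \<partial>M)
          = (\<integral>\<^sup>+\<omega>. emeasure (Q n) {z \<in> space (Q n). \<phi> n (X n \<omega>) z \<in> B} \<partial>M)"
        by (simp add: \<phi>_max[OF n])
      also have "\<dots> = (\<integral>\<^sup>+x. emeasure (Q n) {z \<in> space (Q n). \<phi> n x z \<in> B} \<partial>\<mu> n)"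
        unfolding \<mu>_def
        by (rule nn_integral_distr[OF X[OF n], symmetric])
          (use measurable_kernel_prob[OF Q[OF n] \<phi>[OF n] B] in simp)
      also have "\<dots> = emeasure (\<nu> n) B" using kernel[OF n] B by (auto simp: threshold_kernel_def)
      finally show "(\<integral>\<^sup>+\<omega>. emeasure (Q n) {z \<in> space (Q n). \<phi> n (max (X n \<omega>) (l n)) z \<in> B} \<partial>M)
          = emeasure (\<nu> n) B" .
    qed (use thr Q \<phi> prob_\<nu> sets_\<nu> in auto)
    moreover have "(\<lambda>p. \<lambda>n\<in>{1..}. \<phi> n (max (X n (fst p)) (l n)) (snd p n)) = ys"
      by (auto simp: fun_eq_iff ys_def \<phi>_max restrict_def)
    ultimately show ?thesis by (simp add: S_def R_def)
  qed

  \<comment> \<open>only the joint law of the two sequences matters, so it is realized by coordinate projections\<close>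
  define P where "P = distr (M \<Otimes>\<^sub>M R) (S \<Otimes>\<^sub>M S) (\<lambda>p. (xs p, ys p))"
  have xys: "(\<lambda>p. (xs p, ys p)) \<in> measurable (M \<Otimes>\<^sub>M R) (S \<Otimes>\<^sub>M S)"
    using xs ys by (rule measurable_Pair)
  define X' where "X' n p = fst p n" for n and p :: "(nat \<Rightarrow> real) \<times> (nat \<Rightarrow> real)"
  define Y' where "Y' n p = snd p n" for n and p :: "(nat \<Rightarrow> real) \<times> (nat \<Rightarrow> real)"
  have sets_P: "sets P = sets (S \<Otimes>\<^sub>M S)" by (simp add: P_def)
  have X': "X' n \<in> borel_measurable (S \<Otimes>\<^sub>M S)" and Y': "Y' n \<in> borel_measurable (S \<Otimes>\<^sub>M S)" if "1 \<le> n" for n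
    unfolding X'_def[abs_def] Y'_def[abs_def] S_def using that
    by (auto intro!: measurable_compose[OF measurable_fst] measurable_compose[OF measurable_snd] measurable_component_singleton)
  have pm_X': "partial_max X' n p = partial_max (\<lambda>k z. z k) n (fst p)"
    and pm_Y': "partial_max Y' n p = partial_max (\<lambda>k z. z k) n (snd p)" for n p
    by (simp_all add: partial_max_def X'_def Y'_def)

  have AE_ys: "AE p in M \<Otimes>\<^sub>M R. Pr (ys p)" if "AE z in PiM {1..} \<nu>. Pr z" for Pr
    using that unfolding law_ys[symmetric] by (rule AE_distrD[OF ys])
  \<comment> \<open>condition (iv), transferred from the coordinate sequence to the constructed scheme\<close>
  have above: "AE p in M \<Otimes>\<^sub>M R. \<forall>\<^sub>F n in sequentially. l n < partial_max (\<lambda>k z. z k) n (ys p)"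
    using thr unfolding \<nu>_def[abs_def, symmetric] by (intro AE_ys) (auto simp: \<nu>_def)
  \<comment> \<open>rational levels make this a countable intersection of almost sure events\<close>
  have exceed: "AE p in M \<Otimes>\<^sub>M R. \<forall>q\<in>{q\<in>\<rat>. F q < 1}. \<exists>n\<ge>1. q < ys p n"
  proof (rule AE_ball_countable')
    show "countable {q\<in>\<rat>. F q < 1}" using countable_rat by (rule countable_subset[rotated]) auto
    fix q assume "q \<in> {q\<in>\<rat>. F q < 1}"
    then show "AE p in M \<Otimes>\<^sub>M R. \<exists>n\<ge>1. q < ys p n"
      using thr \<nu> cdf_\<nu> is_df_bounds[OF F] by (intro AE_ys AE_exceeds_level[where c="F q" and \<alpha>=\<alpha>]) auto
  qed
  have Y_less: "AE p in M \<Otimes>\<^sub>M R. \<forall>n\<in>{1..}. F (ys p n) < 1"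
  proof (rule AE_ball_countable')
    fix n :: nat assume n: "n \<in> {1..}"
    then interpret \<nu>n: real_distribution "\<nu> n" using \<nu> by auto
    have "continuous_on UNIV (\<lambda>x. F x powr \<alpha> n)"
      using contF thr n is_df_bounds(1)[OF F] by (intro continuous_on_powr') auto
    then have "AE x in \<nu> n. F x powr \<alpha> n < 1"
      using \<nu>n.AE_cdf_less_1 n by (simp add: cdf_\<nu>)
    then have "AE x in \<nu> n. F x < 1"
    proof eventually_elim
      case (elim x)
      then show ?case using is_df_bounds(2)[OF F, of x] by (cases "F x = 1") auto
    qed
    then have "AE z in PiM {1..} \<nu>. F (z n) < 1"
      using n prob_\<nu> by (intro AE_PiM_component) auto
    then show "AE p in M \<Otimes>\<^sub>M R. F (ys p n) < 1" by (rule AE_ys)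
  qed simp
  have X_less: "AE p in M \<Otimes>\<^sub>M R. \<forall>n\<in>{1..}. F (xs p n) < 1"
  proof (rule AE_ball_countable')
    fix n :: nat assume "n \<in> {1..}"
    then have n: "1 \<le> n" by simp
    have le: "right_endpoint (df_of M (X n)) \<le> right_endpoint F" using thr n by auto
    have "AE \<omega> in M. ereal (X n \<omega>) \<noteq> right_endpoint F"
      using assms(3) n by (auto simp: no_atom_at_right_endpoint_def)
    then have "AE \<omega> in M. ereal (X n \<omega>) < right_endpoint F"
      using M.AE_le_right_endpoint[OF X[OF n]]
      by eventually_elim (use le in \<open>auto simp: order.strict_iff_order\<close>)
    then have "AE \<omega> in M. F (X n \<omega>) < 1"
      by eventually_elim (rule df_less_1_below_right_endpoint[OF F])
    then have "AE \<omega> in distr (M \<Otimes>\<^sub>M R) M fst. F (X n \<omega>) < 1"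
      unfolding distr_fst_pair_prob[OF M.prob_space_axioms R.prob_space_axioms] .
    from AE_distrD[OF measurable_fst this]
    show "AE p in M \<Otimes>\<^sub>M R. F (xs p n) < 1" using n by (simp add: xs_def)
  qed simp
  have coupled: "AE p in M \<Otimes>\<^sub>M R. \<forall>\<^sub>F k in sequentially. l k < xs p k \<or> l k < ys p k \<longrightarrow> ys p k = xs p k"
  proof -
    define D where "D k = {p \<in> space (M \<Otimes>\<^sub>M R). (l k < xs p k \<or> l k < ys p k) \<and> ys p k \<noteq> xs p k}" for k
    have D: "D k \<in> sets (M \<Otimes>\<^sub>M R)" and D_le: "measure (M \<Otimes>\<^sub>M R) (D k) \<le> 2 * tv_on {l k<..} (\<mu> k) (\<nu> k)" if k: "1 \<le> k" for k
    proof -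
      let ?D = "{p \<in> space (\<mu> k \<Otimes>\<^sub>M Q k). (l k < fst p \<or> l k < \<phi> k (fst p) (snd p)) \<and>
        \<phi> k (fst p) (snd p) \<noteq> fst p}"
      have sets_\<mu>Q: "sets (\<mu> k \<Otimes>\<^sub>M Q k) = sets (borel \<Otimes>\<^sub>M Q k)"
        by (intro sets_pair_measure_cong) (auto simp: \<mu>_def)
      have [measurable]: "(\<lambda>p. \<phi> k (fst p) (snd p)) \<in> borel_measurable (borel \<Otimes>\<^sub>M Q k)"
        using \<phi>[OF k] by (simp add: case_prod_beta')
      have "{p \<in> space (borel \<Otimes>\<^sub>M Q k). (l k < fst p \<or> l k < \<phi> k (fst p) (snd p)) \<and>
        \<phi> k (fst p) (snd p) \<noteq> fst p} \<in> sets (borel \<Otimes>\<^sub>M Q k)" by measurable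
      then have D': "?D \<in> sets (borel \<Otimes>\<^sub>M Q k)" by (simp add: sets_eq_imp_space_eq[OF sets_\<mu>Q])
      have comp: "(\<lambda>z. z k) \<in> measurable R (Q k)" "distr R (Q k) (\<lambda>z. z k) = Q k"
        unfolding R_def using Q k by (auto intro!: distr_PiM_component)
      have "\<mu> k \<Otimes>\<^sub>M Q k = distr M borel (X k) \<Otimes>\<^sub>M distr R (Q k) (\<lambda>z. z k)"
        by (simp add: comp \<mu>_def)
      also have "\<dots> = distr (M \<Otimes>\<^sub>M R) (borel \<Otimes>\<^sub>M Q k) (\<lambda>p. (X k (fst p), snd p k))"
        by (subst pair_measure_distr[OF X[OF k] comp(1)])
          (use Q[OF k] in \<open>auto simp: comp(2) case_prod_beta' prob_space_def finite_measure_def\<close>)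
      finally have law: "\<mu> k \<Otimes>\<^sub>M Q k = distr (M \<Otimes>\<^sub>M R) (borel \<Otimes>\<^sub>M Q k) (\<lambda>p. (X k (fst p), snd p k))" .
      have D_eq: "(\<lambda>p. (X k (fst p), snd p k)) -` ?D \<inter> space (M \<Otimes>\<^sub>M R) = D k"
        using measurable_space[OF proj[OF k]] k
        by (auto simp: D_def xs_def ys_def sets_eq_imp_space_eq[OF sets_\<mu>Q])
      show "D k \<in> sets (M \<Otimes>\<^sub>M R)"
        using measurable_sets[OF proj[OF k] D'] unfolding D_eq .
      have "measure (M \<Otimes>\<^sub>M R) (D k) = measure (\<mu> k \<Otimes>\<^sub>M Q k) ?D"
        by (subst (1) law, subst measure_distr[OF proj[OF k] D']) (simp only: D_eq)
      also have "\<dots> \<le> 2 * tv_on {l k<..} (\<mu> k) (\<nu> k)"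
        using kernel[OF k] by (simp add: threshold_kernel_def)
      finally show "measure (M \<Otimes>\<^sub>M R) (D k) \<le> 2 * tv_on {l k<..} (\<mu> k) (\<nu> k)" .
    qed
    \<comment> \<open>Borel--Cantelli; the shift by one is that of condition (iii)\<close>
    have "summable (\<lambda>n. 2 * tv_on {l (Suc n)<..} (\<mu> (Suc n)) (\<nu> (Suc n)))"
      using thr by (intro summable_mult) (auto simp: \<mu>_def \<nu>_def)
    then have "summable (\<lambda>n. measure (M \<Otimes>\<^sub>M R) (D (Suc n)))"
      by (rule summable_comparison_test'[where N=0]) (use D_le in auto)
    then have "AE p in M \<Otimes>\<^sub>M R. \<forall>\<^sub>F n in sequentially. p \<in> space (M \<Otimes>\<^sub>M R) - D (Suc n)"
      using D by (intro borel_cantelli_AE1) (auto simp: less_top[symmetric])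
    then show ?thesis
    proof eventually_elim
      case (elim p)
      then have "\<forall>\<^sub>F n in sequentially. p \<in> space (M \<Otimes>\<^sub>M R) - D n"
        by (rule eventually_sequentially_Suc[THEN iffD1])
      then show ?case by eventually_elim (auto simp: D_def)
    qed
  qed
  have "AE p in M \<Otimes>\<^sub>M R. \<forall>\<^sub>F n in sequentially.
      partial_max X' n (xs p, ys p) = partial_max Y' n (xs p, ys p)"
    using above exceed Y_less X_less coupled
  proof eventually_elim
    case (elim p)
    have beaten: "\<exists>n\<ge>1. v < ys p n" if v: "F v < 1" for v
    proof -
      obtain q where "q \<in> \<rat>" "v < q" "F q < 1" using continuous_df_less_1_extend[OF contF v] by auto
      then show ?thesis using elim(2) by (force intro: less_trans)
    qed
    have "\<forall>\<^sub>F n in sequentially. partial_max (\<lambda>k z. z k) n (xs p) = partial_max (\<lambda>k z. z k) n (ys p)"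
    proof (rule eventually_partial_max_eq[OF l elim(5) elim(1)])
      fix k :: nat assume "1 \<le> k"
      then show "\<exists>n\<ge>1. xs p k < ys p n" "\<exists>n\<ge>1. ys p k < ys p n"
        using elim(3,4) by (auto intro!: beaten simp del: One_nat_def)
    qed
    then show ?case by (simp add: pm_X' pm_Y')
  qed
  moreover have "Measurable.pred (S \<Otimes>\<^sub>M S) (\<lambda>p. \<forall>\<^sub>F n in sequentially. partial_max X' n p = partial_max Y' n p)"
  proof -
    have [measurable]: "partial_max X' n \<in> borel_measurable (S \<Otimes>\<^sub>M S)"
      "partial_max Y' n \<in> borel_measurable (S \<Otimes>\<^sub>M S)" for n
      by (intro borel_measurable_partial_max X' Y'; assumption)+
    show ?thesis unfolding eventually_sequentially by measurable
  qed
  ultimately have ev: "AE p in P. \<forall>\<^sub>F n in sequentially. partial_max X' n p = partial_max Y' n p"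
    unfolding P_def by (subst AE_distr_iff[OF xys]) (auto simp: pred_def)

  have law_X': "seq_law P X' = seq_law M X"
  proof -
    have "(\<lambda>p. \<lambda>n\<in>{1..}. X' n p) \<in> measurable (S \<Otimes>\<^sub>M S) S"
      using X' unfolding S_def by (intro measurable_restrict) simp
    from distr_distr[OF this xys]
    have "distr P S (\<lambda>p. \<lambda>n\<in>{1..}. X' n p) = distr (M \<Otimes>\<^sub>M R) S xs"
      by (simp add: P_def comp_def X'_def xs_def[abs_def] cong: restrict_cong)
    then show ?thesis unfolding seq_law_def[of P] S_def[symmetric] law_xs .
  qed
  have law_Y': "seq_law P Y' = seq_law N Y"
  proof -
    have "(\<lambda>p. \<lambda>n\<in>{1..}. Y' n p) \<in> measurable (S \<Otimes>\<^sub>M S) S"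
      using Y' unfolding S_def by (intro measurable_restrict) simp
    from distr_distr[OF this xys]
    have "distr P S (\<lambda>p. \<lambda>n\<in>{1..}. Y' n p) = distr (M \<Otimes>\<^sub>M R) S ys"
      by (simp add: P_def comp_def Y'_def ys_def[abs_def] cong: restrict_cong)
    then show ?thesis unfolding seq_law_def[of P] S_def[symmetric] law_ys law_Y .
  qed
  have prob_P: "prob_space P" unfolding P_def by (rule MR.prob_space_distr[OF xys])
  have meas_P: "X' n \<in> borel_measurable P" "Y' n \<in> borel_measurable P" if "1 \<le> n" for n
    unfolding measurable_cong_sets[OF sets_P refl] using X'[OF that] Y'[OF that] .
  obtain T :: "(nat \<Rightarrow> real) \<times> (nat \<Rightarrow> real) \<Rightarrow> enat"
    where T: "T \<in> measurable P (count_space UNIV)" "AE p in P. T p < \<infinity>"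
    and agree: "\<And>p n. 1 \<le> n \<Longrightarrow> T p \<le> enat n \<Longrightarrow>
      (partial_max X' n p, record_indicator X' n p) = (partial_max Y' n p, record_indicator Y' n p)"
    using coupling_time[OF meas_P ev] by blast
  show ?thesis
    using prob_P meas_P law_X' law_Y' T agree
    by (intro exI[of _ P] exI[of _ X'] exI[of _ Y'] exI[of _ T]) blast
qed

end
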